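(* Let $B$ be a complex Banach space and let $\Sigma:=\{z\in\mathbb C:\ 0\le \mathrm{Im}(z)\le \pi\}$. The complex vector subspace of $C_b^B(\Sigma)$ spanned over $B$ by the functions $z\mapsto e^{i\lambda z}$, $\lambda\in\mathbb R$ (that is, the set of all finite sums $z\mapsto\sum_{k=1}^m b_k e^{i\lambda_k z}$ with $b_k\in B$, $\lambda_k\in\mathbb R$), is dense in $APH_B(\Sigma)$.
   Context: $C_b^B(\Sigma)$ denotes the Banach space of bounded continuous functions $f:\Sigma\to B$ with the norm $\|f\|:=\sup_{z\in\Sigma}\|f(z)\|_B$. For $x\in\mathbb R$ the shift $S_xf$ is $S_xf(z):=f(z+x)$. A function $f\in C_b^B(\Sigma)$ is called holomorphic almost periodic on $\Sigma$ if it is holomorphic in the interior of $\Sigma$ and the family of shifts $\{S_xf\}_{x\in\mathbb R}$ is relatively compact in $C_b^B(\Sigma)$. $APH_B(\Sigma)\subset C_b^B(\Sigma)$ is the Banach space of all such functions, with the sup-norm. *)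

theory Defs
  imports "HOL-Complex_Analysis.Complex_Analysis"
begin

text \<open>
  A complex Banach space is rendered as a real Banach space carrying a compatible complex
  scalar multiplication; the compatibility with real scalars only says that the real structure
  of the type is the restriction of the complex one.
\<close>

class complex_normed_vector = real_normed_vector +
  fixes scaleC :: "complex \<Rightarrow> 'a \<Rightarrow> 'a" (infixr \<open>*\<^sub>C\<close> 75)
  assumes scaleC_add_right: "a *\<^sub>C (x + y) = a *\<^sub>C x + a *\<^sub>C y"
    and scaleC_add_left: "(a + b) *\<^sub>C x = a *\<^sub>C x + b *\<^sub>C x"
    and scaleC_scaleC: "a *\<^sub>C b *\<^sub>C x = (a * b) *\<^sub>C x"
    and scaleC_one: "1 *\<^sub>C x = x"
    and scaleR_scaleC: "r *\<^sub>R x = complex_of_real r *\<^sub>C x"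
    and norm_scaleC: "norm (a *\<^sub>C x) = cmod a * norm x"

class complex_banach = complex_normed_vector + banach

instantiation complex :: complex_banach
begin

definition scaleC_complex :: "complex \<Rightarrow> complex \<Rightarrow> complex" where
  "scaleC_complex a x = a * x"

instance
  by standard (auto simp: scaleC_complex_def algebra_simps norm_mult scaleR_conv_of_real)

end

text \<open>The library's \<open>holomorphic_on\<close> covers only complex-valued functions.\<close>

definition vec_holomorphic_on :: "(complex \<Rightarrow> 'b::complex_banach) \<Rightarrow> complex set \<Rightarrow> bool" where
  "vec_holomorphic_on f S \<longleftrightarrow>
     (\<forall>z\<in>S. \<exists>D. (f has_derivative (\<lambda>h. h *\<^sub>C D)) (at z within S))"

lemma vec_holomorphic_on_complex:
  fixes f :: "complex \<Rightarrow> complex"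
  shows "vec_holomorphic_on f S \<longleftrightarrow> f holomorphic_on S"
  unfolding vec_holomorphic_on_def holomorphic_on_def field_differentiable_def
    has_field_derivative_def scaleC_complex_def
  by (simp add: mult.commute)

definition strip :: "complex set" where
  "strip = {z. 0 \<le> Im z \<and> Im z \<le> pi}"

text \<open>
  The space of bounded continuous functions on \<open>S\<close> with the sup-distance. Its elements are
  functions on the whole plane that are \<open>undefined\<close> off \<open>S\<close>, so that functions agreeing on
  \<open>S\<close> are equal.
\<close>

definition Cb :: "complex set \<Rightarrow> (complex \<Rightarrow> 'b::complex_banach) metric" where
  "Cb S = cfunspace (top_of_set S) euclidean_metric"

lemma mspace_Cb:
  "mspace (Cb S :: (complex \<Rightarrow> 'b::complex_banach) metric) =
     {f. f \<in> extensional S \<and> continuous_on S f \<and> bounded (f ` S)}"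
proof -
  have "Met_TC.mbounded A = bounded A" for A :: "'b set"
    by (auto simp: Met_TC.mbounded bounded_def)
  then show ?thesis
    by (auto simp: Cb_def)
qed

lemma mdist_Cb:
  assumes "f \<in> mspace (Cb S)" "g \<in> mspace (Cb S)" "S \<noteq> {}"
  shows "mdist (Cb S) f g = (SUP z\<in>S. norm (f z - g z))"
proof -
  have "f \<in> Met_TC.fspace S" "g \<in> Met_TC.fspace S"
    using assms(1,2) by (simp_all add: Cb_def Met_TC.fspace_def)
  then show ?thesis
    using assms(3)
    by (simp add: Cb_def mdist_cfunspace_eq_mdist_funspace Met_TC.fdist_def dist_norm)
qed

definition shift :: "complex set \<Rightarrow> real \<Rightarrow> (complex \<Rightarrow> 'b) \<Rightarrow> complex \<Rightarrow> 'b" where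
  "shift S x f = restrict (\<lambda>z. f (z + complex_of_real x)) S"

lemma shift_in_Cb:
  fixes f :: "complex \<Rightarrow> 'b::complex_banach"
  assumes "f \<in> mspace (Cb strip)"
  shows "shift strip x f \<in> mspace (Cb strip)"
proof -
  have im: "(\<lambda>z. z + complex_of_real x) ` strip \<subseteq> strip"
    by (auto simp: strip_def)
  have "continuous_on strip (\<lambda>z. f (z + complex_of_real x))"
  proof (rule continuous_on_compose2[OF _ _ im])
    show "continuous_on strip f"
      using assms by (simp add: mspace_Cb)
  qed (intro continuous_intros)
  moreover have "bounded (shift strip x f ` strip)"
  proof (rule bounded_subset)
    show "bounded (f ` strip)"
      using assms by (simp add: mspace_Cb)
    show "shift strip x f ` strip \<subseteq> f ` strip"
      using im by (force simp: shift_def)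
  qed
  ultimately show ?thesis
    by (simp add: mspace_Cb shift_def)
qed

text \<open>
  Relative compactness in \<open>Cb S\<close>: the closure in \<open>Cb S\<close> is compact. The operator \<open>closure_of\<close>
  discards points outside the space; for \<open>S = strip\<close> none of the shifts is lost
  (see lemma \<open>shift_in_Cb\<close>).
\<close>

definition APH :: "complex set \<Rightarrow> (complex \<Rightarrow> 'b::complex_banach) metric" where
  "APH S = submetric (Cb S)
     {f. vec_holomorphic_on f (interior S) \<and>
         compactin (mtopology_of (Cb S)) (mtopology_of (Cb S) closure_of range (\<lambda>x. shift S x f))}"

definition exp_sums :: "complex set \<Rightarrow> (complex \<Rightarrow> 'b::complex_banach) set" where
  "exp_sums S =
     {restrict (\<lambda>z. \<Sum>k = 1..m. exp (\<i> * complex_of_real (l k) * z) *\<^sub>C b k) S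
       | (m::nat) (l::nat \<Rightarrow> real) (b::nat \<Rightarrow> 'b). True}"

end

(*
  Bounded continuous functions on the strip form a Banach space on which the real translations act
  isometrically, and f has a relatively compact orbit. Sample the orbit with a small step h over a
  long almost period N h and use finite Fourier analysis on Z/N: since the almost periods of f have
  density bounded below, averaging f over sums of three of them gives f up to epsilon as a sum of
  boundedly many multiples of discrete Fourier coefficients. These lie in the compact closed
  absolutely convex hull of the orbit and are almost eigenvectors of the translations, so letting
  h -> 0 and N h -> infinity they are close to exact eigenvectors. An eigenvector that is holomorphic
  (tested by functionals, which separate points by Hahn-Banach) is exp(i l z) b.
*)
theory Submission
  imports Defs
begin

section \<open>Linear functionals separate points\<close>

text \<open>The order of the choices matters. Moving one term to an exact eigenvector costs
  \<delta>, and these costs add up, so the number of terms must be bounded before \<delta> is fixed;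
  compactness then yields a step \<open>h\<close> for this \<delta>, and only then is
  \<open>N\<close> taken large. This is why the density of almost periods has to be uniform in
  \<open>h\<close> and \<open>N\<close>. The zero vector counts as an eigenvector, so the Fourier
  coefficients need no lower bound on their norms. Working on Z/N keeps every mean a finite sum:
  neither vector-valued integrals nor limits of means over growing intervals occur. Holomorphy
  survives the limit because the closed hull stays in every closed complex subspace that contains
  the orbit.\<close>

lemma bounded_bilinear_scaleC:
  "bounded_bilinear (scaleC :: complex \<Rightarrow> 'a \<Rightarrow> 'a::complex_normed_vector)"
proof
  show "\<exists>K. \<forall>a (b::'a). norm (a *\<^sub>C b) \<le> norm a * norm b * K"
    by (rule exI[of _ 1]) (simp add: norm_scaleC)
qed (simp_all add: scaleC_add_left scaleC_add_right scaleR_scaleC scaleC_scaleC scaleC_complex_def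
      scaleR_conv_of_real mult.commute)

interpretation scaleC: bounded_bilinear "scaleC :: complex \<Rightarrow> 'a \<Rightarrow> 'a::complex_normed_vector"
  by (rule bounded_bilinear_scaleC)

text \<open>Homogeneity is stated one-sidedly because an infimum satisfies this form directly;
  applying it with the factor \<open>inverse t\<close> recovers equality.\<close>

definition sublinear :: "('a::real_vector \<Rightarrow> real) \<Rightarrow> bool" where
  "sublinear p \<longleftrightarrow> (\<forall>x y. p (x + y) \<le> p x + p y) \<and> p 0 = 0 \<and> (\<forall>t>0. \<forall>x. p (t *\<^sub>R x) \<le> t * p x)"

lemma sublinear_add: "sublinear p \<Longrightarrow> p (x + y) \<le> p x + p y"
  and sublinear_zero: "sublinear p \<Longrightarrow> p 0 = 0"
  and sublinear_scaleR_le: "sublinear p \<Longrightarrow> 0 < t \<Longrightarrow> p (t *\<^sub>R x) \<le> t * p x"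
  by (auto simp: sublinear_def)

lemma sublinear_scaleR:
  assumes "sublinear p" "t \<ge> 0" shows "p (t *\<^sub>R x) = t * p x"
proof (cases "t = 0")
  case False
  then have t: "t > 0" using assms(2) by simp
  have "p (inverse t *\<^sub>R t *\<^sub>R x) \<le> inverse t * p (t *\<^sub>R x)"
    using t by (intro sublinear_scaleR_le assms) auto
  then have "t * p x \<le> p (t *\<^sub>R x)"
    using t by (simp add: field_simps)
  then show ?thesis using sublinear_scaleR_le[OF assms(1) t, of x] by linarith
qed (simp add: sublinear_zero[OF assms(1)])

lemma sublinear_uminus: "sublinear p \<Longrightarrow> - p (- x) \<le> p x"
  using sublinear_add[of p x "- x"] sublinear_zero[of p] by simp

text \<open>
  The tilted functional lies below \<open>p\<close>. It differs from \<open>p\<close> for some \<open>y\<close> unless \<open>p\<close> is additive, so a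
  minimal sublinear functional is linear.
\<close>

definition tilt :: "('a::real_vector \<Rightarrow> real) \<Rightarrow> 'a \<Rightarrow> 'a \<Rightarrow> real" where
  "tilt p y x = (INF t\<in>{0..}. p (x + t *\<^sub>R y) - t * p y)"

lemma tilt_le:
  assumes p: "sublinear p" and t: "t \<ge> 0"
  shows "tilt p y x \<le> p (x + t *\<^sub>R y) - t * p y"
  unfolding tilt_def
proof (rule cINF_lower)
  \<comment> \<open>Subadditivity for \<open>s y = (x + s y) + (- x)\<close>: the values are bounded
    below, so the infimum is meaningful.\<close>
  have "- p (- x) \<le> p (x + s *\<^sub>R y) - s * p y" if "s \<ge> 0" for s
    using sublinear_add[OF p, of "x + s *\<^sub>R y" "- x"] sublinear_scaleR[OF p that, of y] by simp
  then show "bdd_below ((\<lambda>t. p (x + t *\<^sub>R y) - t * p y) ` {0..})"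
    by (intro bdd_belowI2[where m = "- p (- x)"]) auto
qed (use t in simp)

lemma tilt_greatest:
  "(\<And>t. t \<ge> 0 \<Longrightarrow> m \<le> p (x + t *\<^sub>R y) - t * p y) \<Longrightarrow> m \<le> tilt p y x"
  unfolding tilt_def by (rule cINF_greatest) auto

text \<open>Parameters \<open>t\<close> for \<open>x\<close> and \<open>s\<close> for
  \<open>x'\<close> combine to \<open>t + s\<close> for \<open>x + x'\<close>, and the two infima
  are taken one after the other. Scaling \<open>x\<close> by \<open>t\<close> replaces the parameter
  \<open>s\<close> by \<open>t * s\<close>.\<close>

lemma sublinear_tilt:
  assumes p: "sublinear p" shows "sublinear (tilt p y)"
  unfolding sublinear_def
proof (intro conjI allI impI)
  fix x x'
  have "tilt p y (x + x') - (p (x + t *\<^sub>R y) - t * p y) \<le> tilt p y x'" if "t \<ge> 0" for t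
  proof (rule tilt_greatest)
    fix s :: real assume "s \<ge> 0"
    then have "tilt p y (x + x') \<le> p ((x + x') + (t + s) *\<^sub>R y) - (t + s) * p y"
      using that by (intro tilt_le p) auto
    also have "p ((x + x') + (t + s) *\<^sub>R y) \<le> p (x + t *\<^sub>R y) + p (x' + s *\<^sub>R y)"
      using sublinear_add[OF p, of "x + t *\<^sub>R y" "x' + s *\<^sub>R y"] by (simp add: algebra_simps)
    finally show "tilt p y (x + x') - (p (x + t *\<^sub>R y) - t * p y) \<le> p (x' + s *\<^sub>R y) - s * p y"
      by (simp add: algebra_simps)
  qed
  then have "tilt p y (x + x') - tilt p y x' \<le> tilt p y x"
    by (intro tilt_greatest) (force simp: algebra_simps)
  then show "tilt p y (x + x') \<le> tilt p y x + tilt p y x'" by simp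
next
  show "tilt p y 0 = 0"
    by (intro antisym order.trans[OF tilt_le[OF p order_refl]] tilt_greatest)
      (simp_all add: sublinear_zero[OF p] sublinear_scaleR[OF p])
next
  fix t :: real and x assume t: "t > 0"
  have "tilt p y (t *\<^sub>R x) / t \<le> tilt p y x"
  proof (rule tilt_greatest)
    fix s :: real assume s: "s \<ge> 0"
    have "tilt p y (t *\<^sub>R x) \<le> p (t *\<^sub>R x + (t * s) *\<^sub>R y) - (t * s) * p y"
      using s t by (intro tilt_le p) auto
    also have "\<dots> = t * (p (x + s *\<^sub>R y) - s * p y)"
      using sublinear_scaleR[OF p, of t "x + s *\<^sub>R y"] t by (simp add: algebra_simps)
    finally show "tilt p y (t *\<^sub>R x) / t \<le> p (x + s *\<^sub>R y) - s * p y"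
      using t by (simp add: field_simps)
  qed
  then show "tilt p y (t *\<^sub>R x) \<le> t * tilt p y x" using t by (simp add: field_simps)
qed

lemma tilt_le_self: "sublinear p \<Longrightarrow> tilt p y x \<le> p x"
  using tilt_le[of p 0 y x] by simp

lemma linear_if_minimal_sublinear:
  assumes p: "sublinear p" and min: "\<And>q. sublinear q \<Longrightarrow> (\<And>x. q x \<le> p x) \<Longrightarrow> q = p"
  shows "linear p"
proof -
  have add: "p (x + y) = p x + p y" for x y
  proof -
    have "tilt p y = p" by (intro min sublinear_tilt tilt_le_self p)
    then have "p x \<le> p (x + y) - p y" using tilt_le[OF p, of 1 y x] by simp
    then show ?thesis using sublinear_add[OF p, of x y] by linarith
  qed
  have neg: "p (- x) = - p x" for x
    using add[of x "- x"] sublinear_zero[OF p] by simp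
  show ?thesis
  proof (rule linearI)
    show "p (c *\<^sub>R x) = c *\<^sub>R p x" for c x
      using sublinear_scaleR[OF p, of c x] sublinear_scaleR[OF p, of "- c" x] neg[of "(- c) *\<^sub>R x"]
      by (cases "c \<ge> 0") auto
  qed (rule add)
qed

text \<open>Zorn's lemma for the sublinear functionals below \<open>P\<close>, ordered downwards:
  the pointwise infimum bounds a chain, and a maximal element for this order is a minimal
  functional, hence linear. The bound \<open>- P (- x)\<close>, common to all members, keeps the
  infima finite.\<close>

theorem Hahn_Banach_sublinear:
  assumes P: "sublinear P"
  obtains p where "linear p" "\<And>x. p x \<le> P x"
proof -
  define A where "A = {p. sublinear p \<and> (\<forall>x. p x \<le> P x)}"
  define R where "R = (\<lambda>(p::'a \<Rightarrow> real) q. \<forall>x. q x \<le> p x)"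
  have low: "- P (- x) \<le> p x" if "p \<in> A" for p x
    using that sublinear_uminus[of p x] unfolding A_def
    by (smt (verit) mem_Collect_eq)
  have "\<exists>m\<in>A. \<forall>a\<in>A. R m a \<longrightarrow> a = m"
  proof (rule predicate_Zorn)
    show "partial_order_on A (relation_of R A)"
      by (rule partial_order_on_relation_ofI) (auto simp: R_def intro!: ext intro: order.trans antisym)
  next
    fix C assume C: "C \<in> Chains (relation_of R A)"
    have CA: "C \<subseteq> A" by (rule Chains_relation_of[OF C])
    show "\<exists>u\<in>A. \<forall>a\<in>C. R a u"
    proof (cases "C = {}")
      case True
      then show ?thesis using P by (auto simp: A_def)
    next
      case ne: False
      define u where "u = (\<lambda>x. INF p\<in>C. p x)"
      have u_le: "u x \<le> p x" if "p \<in> C" for p x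
        unfolding u_def using that low CA by (intro cINF_lower bdd_belowI2[where m="- P (- x)"]) auto
      have u_ge: "m \<le> u x" if "\<And>p. p \<in> C \<Longrightarrow> m \<le> p x" for m x
        unfolding u_def using that ne by (intro cINF_greatest) auto
      have sub: "sublinear p" if "p \<in> C" for p using that CA by (auto simp: A_def)
      have "sublinear u"
        unfolding sublinear_def
      proof (intro conjI allI impI)
        fix x y
        have "u (x + y) - p x \<le> u y" if p: "p \<in> C" for p
        proof (rule u_ge)
          fix q assume q: "q \<in> C"
          \<comment> \<open>Of two members of a chain one lies below both, and its subadditivity
            serves for \<open>p\<close> at \<open>x\<close> and \<open>q\<close> at \<open>y\<close>
            together.\<close>
          have "R p q \<or> R q p" using C p q by (auto simp: Chains_def relation_of_def)
          then obtain r where r: "r \<in> C" "r x \<le> p x" "r y \<le> q y"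
            using p q by (auto simp: R_def)
          show "u (x + y) - p x \<le> q y"
            using u_le[OF r(1), of "x + y"] sublinear_add[OF sub[OF r(1)], of x y] r by linarith
        qed
        then have "u (x + y) - u y \<le> u x"
          by (intro u_ge) (force simp: algebra_simps)
        then show "u (x + y) \<le> u x + u y" by simp
      next
        show "u 0 = 0"
          unfolding u_def using ne sub by (subst INF_cong[OF refl sublinear_zero]) auto
      next
        fix t :: real and x assume t: "t > 0"
        have "u (t *\<^sub>R x) / t \<le> u x"
        proof (rule u_ge)
          fix p assume "p \<in> C"
          then show "u (t *\<^sub>R x) / t \<le> p x"
            using u_le[of p "t *\<^sub>R x"] sublinear_scaleR[OF sub, of p t x] t by (simp add: field_simps)
        qed
        then show "u (t *\<^sub>R x) \<le> t * u x" using t by (simp add: field_simps)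
      qed
      moreover have "u x \<le> P x" for x
      proof -
        obtain p where p: "p \<in> C" using ne by blast
        then have "p x \<le> P x" using CA by (auto simp: A_def)
        then show ?thesis using u_le[OF p, of x] by linarith
      qed
      ultimately have "u \<in> A" by (simp add: A_def)
      then show ?thesis using u_le by (auto simp: R_def)
    qed
  qed
  then obtain p where p: "p \<in> A" and min: "\<And>a. a \<in> A \<Longrightarrow> R p a \<Longrightarrow> a = p" by blast
  show thesis
  proof (rule that[OF linear_if_minimal_sublinear])
    show "q = p" if "sublinear q" "\<And>x. q x \<le> p x" for q
      using that p by (intro min) (auto simp: A_def R_def intro: order.trans)
  qed (use p in \<open>auto simp: A_def\<close>)
qed

text \<open>Hahn-Banach is applied to \<open>tilt norm v\<close> rather than to the norm. At
  \<open>- v\<close> this functional is at most \<open>- norm v\<close> (parameter 1), which forces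
  \<open>p v = norm v\<close> without an extension from the line through \<open>v\<close>.\<close>

lemma norming_real_functional:
  fixes v :: "'a::real_normed_vector"
  obtains p where "linear p" "\<And>x. \<bar>p x\<bar> \<le> norm x" "p v = norm v"
proof -
  have n: "sublinear (norm :: 'a \<Rightarrow> real)"
    by (simp add: sublinear_def norm_triangle_ineq)
  obtain p where p: "linear p" and le: "\<And>x. p x \<le> tilt norm v x"
    using Hahn_Banach_sublinear[OF sublinear_tilt[OF n]] by blast
  have le': "p x \<le> norm x" for x using le[of x] tilt_le_self[OF n, of v x] by linarith
  show thesis
  proof (rule that[OF p])
    show "\<bar>p x\<bar> \<le> norm x" for x
      using le'[of x] le'[of "- x"] linear_neg[OF p, of x] by simp
    have "p (- v) \<le> - norm v"
      using le[of "- v"] tilt_le[OF n, of 1 v "- v"] by simp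
    then show "p v = norm v" using le'[of v] linear_neg[OF p, of v] by simp
  qed
qed

definition clinear_functional :: "('a::complex_normed_vector \<Rightarrow> complex) \<Rightarrow> bool" where
  "clinear_functional \<phi> \<longleftrightarrow> bounded_linear \<phi> \<and> (\<forall>a x. \<phi> (a *\<^sub>C x) = a * \<phi> x)"

text \<open>The real norming functional \<open>p\<close> is the real part of the complex-linear
  functional p(x) - i p(ix), which therefore does not vanish at \<open>v\<close>.\<close>

proposition clinear_functional_separates:
  fixes v :: "'a::complex_normed_vector"
  assumes "v \<noteq> 0"
  obtains \<phi> where "clinear_functional \<phi>" "\<phi> v \<noteq> 0"
proof -
  obtain p :: "'a \<Rightarrow> real" where p: "linear p" "\<And>x. \<bar>p x\<bar> \<le> norm x" "p v = norm v"
    using norming_real_functional by blast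
  note lin = linear_add[OF p(1)] linear_cmul[OF p(1)] linear_neg[OF p(1)]
  define \<phi> where "\<phi> x = Complex (p x) (- p (\<i> *\<^sub>C x))" for x
  have scale: "\<phi> (a *\<^sub>C x) = a * \<phi> x" for a x
  proof -
    have "a *\<^sub>C x = Re a *\<^sub>R x + Im a *\<^sub>R (\<i> *\<^sub>C x)"
      using complex_eq[of a] by (simp add: scaleR_scaleC scaleC_scaleC mult.commute flip: scaleC_add_left)
    moreover have "\<i> *\<^sub>C a *\<^sub>C x = Re a *\<^sub>R (\<i> *\<^sub>C x) + (- Im a) *\<^sub>R x"
    proof -
      have "\<i> * a = of_real (Re a) * \<i> + of_real (- Im a)" by (simp add: complex_eq_iff)
      then show ?thesis by (simp add: scaleR_scaleC scaleC_scaleC del: of_real_minus flip: scaleC_add_left)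
    qed
    ultimately show ?thesis
      by (simp add: \<phi>_def lin complex_eq_iff del: scaleR_minus_left) 
  qed
  have "bounded_linear \<phi>"
  proof (rule bounded_linear_intro)
    show "\<phi> (x + y) = \<phi> x + \<phi> y" for x y
      by (simp add: \<phi>_def lin scaleC_add_right complex_eq_iff)
    show "\<phi> (r *\<^sub>R x) = r *\<^sub>R \<phi> x" for r x
      by (simp add: scaleR_scaleC scale scaleC_complex_def)
    show "norm (\<phi> x) \<le> norm x * 2" for x
      using cmod_le[of "\<phi> x"] p(2)[of x] p(2)[of "\<i> *\<^sub>C x"] by (simp add: \<phi>_def norm_scaleC)
  qed
  moreover have "\<phi> v \<noteq> 0" using p(3) assms by (simp add: \<phi>_def complex_eq_iff)
  ultimately show thesis using scale that by (auto simp: clinear_functional_def)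
qed

section \<open>Characters of the cyclic group\<close>

definition root_char :: "nat \<Rightarrow> nat \<Rightarrow> nat \<Rightarrow> complex" where
  "root_char N r t = cis (2 * pi * real r * real t / real N)"

lemma norm_root_char [simp]: "cmod (root_char N r t) = 1"
  by (simp add: root_char_def)

lemma root_char_add: "root_char N r (s + t) = root_char N r s * root_char N r t"
  by (simp add: root_char_def cis_mult distrib_left add_divide_distrib)

lemma root_char_mod: "root_char N r (t mod N) = root_char N r t"
proof (cases "N = 0")
  case False
  have "real t = real N * real (t div N) + real (t mod N)"
    by (metis mult_div_mod_eq of_nat_add of_nat_mult)
  then have "2 * pi * real r * real t / real N
      = 2 * pi * real (r * (t div N)) + 2 * pi * real r * real (t mod N) / real N"
    using False by (simp add: field_simps)
  then show ?thesis
    by (simp add: root_char_def cis_mult [symmetric] cis_multiple_2pi del: of_nat_mult)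
qed simp

text \<open>Summation runs over the frequency \<open>r\<close>. The terms are the powers of an N-th
  root of unity, which differs from 1 when \<open>s\<close> and \<open>t\<close> do because their
  distance is less than \<open>N\<close>; the geometric sum then vanishes.\<close>

lemma root_char_orthogonal:
  assumes "s < N" "t < N"
  shows "(\<Sum>r<N. root_char N r s * cnj (root_char N r t)) = (if s = t then of_nat N else 0)"
proof (cases "s = t")
  case True
  then show ?thesis by (simp add: complex_norm_square [symmetric])
next
  case False
  define w where "w = cis (2 * pi * (real s - real t) / real N)"
  have "root_char N r s * cnj (root_char N r t) = w ^ r" for r
  proof -
    have "2 * pi * real r * real s / real N + - (2 * pi * real r * real t / real N)
        = real r * (2 * pi * (real s - real t) / real N)"
      by (simp add: algebra_simps diff_divide_distrib)
    then show ?thesis by (simp add: root_char_def w_def cis_cnj cis_mult Complex.DeMoivre del: add_uminus_conv_diff)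
  qed
  moreover have "w ^ N = 1"
  proof -
    have "real N * (2 * pi * (real s - real t) / real N) = 2 * pi * real s - 2 * pi * real t"
      using assms by (simp add: field_simps)
    then have "w ^ N = cis (2 * pi * real s) / cis (2 * pi * real t)"
      by (simp only: w_def Complex.DeMoivre cis_divide)
    then show ?thesis by (simp add: cis_multiple_2pi)
  qed
  moreover have "w \<noteq> 1"
  proof
    assume "w = 1"
    then have "cos (2 * pi * (real s - real t) / real N) = 1"
      by (simp add: w_def complex_eq_iff)
    then obtain i :: int where "2 * pi * (real s - real t) / real N = of_int i * 2 * pi"
      by (auto simp: cos_one_2pi_int)
    then have "(2 * pi) * (real s - real t) = (2 * pi) * (of_int i * real N)"
      using assms by (simp add: field_simps)
    then have "real s - real t = of_int i * real N" by (simp only: mult_cancel_left) simp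
    then have "real_of_int (int s - int t) = real_of_int (i * int N)" by simp
    then have eq: "int s - int t = i * int N" by (simp only: of_int_eq_iff)
    then have "int N dvd int s - int t" by simp
    moreover have "\<bar>int s - int t\<bar> < int N" using assms by auto
    ultimately show False using False by (metis dvd_imp_le_int eq_iff_diff_eq_0 leD of_nat_eq_iff abs_of_nat)
  qed
  ultimately show ?thesis using False geometric_sum[of w N] by simp
qed

text \<open>The Fourier transform, up to the sign of the frequency, of the uniform probability
  measure on \<open>E\<close>; its cube belongs to the threefold convolution, that is, to averaging
  over sums of three elements of \<open>E\<close>.\<close>

definition char_mean :: "nat \<Rightarrow> nat set \<Rightarrow> nat \<Rightarrow> complex" where
  "char_mean N E r = (\<Sum>t\<in>E. root_char N r t) / of_nat (card E)"

lemma norm_char_mean: "cmod (char_mean N E r) \<le> 1"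
proof -
  have "cmod (\<Sum>t\<in>E. root_char N r t) \<le> (\<Sum>t\<in>E. 1)" by (rule sum_norm_le) simp
  then show ?thesis by (cases "card E = 0") (auto simp: char_mean_def norm_divide)
qed

text \<open>Expanding the square gives a double sum over \<open>E\<close>, of which orthogonality
  leaves the diagonal: \<open>card E\<close> terms equal to \<open>N\<close>.\<close>

lemma char_mean_Parseval:
  assumes E: "E \<subseteq> {..<N}" "E \<noteq> {}"
  shows "(\<Sum>r<N. (cmod (char_mean N E r))\<^sup>2) = real N / real (card E)"
proof -
  have fin: "finite E" using E finite_subset by blast
  have "complex_of_real (\<Sum>r<N. (cmod (char_mean N E r))\<^sup>2)
      = (\<Sum>r<N. char_mean N E r * cnj (char_mean N E r))"
    by (simp add: complex_norm_square [symmetric])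
  also have "\<dots> = (\<Sum>r<N. \<Sum>s\<in>E. \<Sum>t\<in>E. root_char N r s * cnj (root_char N r t)) / of_nat (card E)^2"
    by (simp add: char_mean_def sum_product power2_eq_square sum_divide_distrib)
  also have "(\<Sum>r<N. \<Sum>s\<in>E. \<Sum>t\<in>E. root_char N r s * cnj (root_char N r t))
      = (\<Sum>s\<in>E. \<Sum>t\<in>E. \<Sum>r<N. root_char N r s * cnj (root_char N r t))"
    by (simp add: sum.swap[of _ E "{..<N}"])
  also have "\<dots> = (\<Sum>s\<in>E. \<Sum>t\<in>E. if s = t then of_nat N else 0)"
    using E by (intro sum.cong refl root_char_orthogonal) auto
  also have "\<dots> = of_nat (card E) * of_nat N" using fin by simp
  finally have "complex_of_real (\<Sum>r<N. (cmod (char_mean N E r))\<^sup>2)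
      = complex_of_real (real N / real (card E))"
    using E fin by (simp add: power2_eq_square)
  then show ?thesis by (simp only: of_real_eq_iff)
qed

text \<open>Each unit shift of the window lets one term in and one term out, which costs at most
  \<open>2 * M\<close>.\<close>

lemma norm_sum_shift_diff:
  fixes a :: "nat \<Rightarrow> 'a::real_normed_vector"
  assumes "\<And>t. norm (a t) \<le> M"
  shows "norm ((\<Sum>t<N. a (t + q)) - (\<Sum>t<N. a t)) \<le> real q * (2 * M)"
proof (induction q)
  case (Suc q)
  have "(\<Sum>t<N. a (t + Suc q)) = (\<Sum>t<N. a (t + q)) + (a (N + q) - a q)"
    using sum.lessThan_Suc_shift[of "\<lambda>t. a (t + q)" N] by (simp add: algebra_simps)
  then have "(\<Sum>t<N. a (t + Suc q)) - (\<Sum>t<N. a t)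
      = ((\<Sum>t<N. a (t + q)) - (\<Sum>t<N. a t)) + (a (N + q) - a q)" by simp
  moreover have "norm (a (N + q) - a q) \<le> 2 * M"
    using norm_triangle_ineq4[of "a (N + q)" "a q"] assms[of "N + q"] assms[of q] by linarith
  ultimately show ?case
    using Suc.IH norm_triangle_ineq[of "(\<Sum>t<N. a (t + q)) - (\<Sum>t<N. a t)" "a (N + q) - a q"]
    by (simp only: of_nat_Suc distrib_right mult_1)
qed simp

section \<open>Absolutely convex hulls\<close>

text \<open>Points are listed with repetition allowed, so a combination of orbit samples that happen
  to coincide needs no regrouping.\<close>

definition absconvex_hull :: "'a::complex_normed_vector set \<Rightarrow> 'a set" where
  "absconvex_hull S = {\<Sum>i<n. a i *\<^sub>C x i | (n::nat) a x. (\<forall>i<n. x i \<in> S) \<and> (\<Sum>i<n. cmod (a i)) \<le> 1}"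

text \<open>Inserting an index adds the multiples of one vector by the closed unit disc, a compact
  set, and sums of compact sets are compact. Each coefficient is bounded separately, so the set
  contains the absolutely convex combinations of the vectors.\<close>

lemma compact_disc_combinations:
  fixes v :: "'i \<Rightarrow> 'a::complex_normed_vector"
  assumes "finite I"
  shows "compact {\<Sum>i\<in>I. b i *\<^sub>C v i | b. \<forall>i\<in>I. cmod (b i) \<le> 1}"
  using assms
proof (induction I)
  case (insert p I)
  have "compact ((\<lambda>a. a *\<^sub>C v p) ` cball 0 1)"
    by (intro compact_continuous_image continuous_intros scaleC.continuous_on) auto
  from compact_sums[OF this insert.IH]
  have "compact {x + y |x y. x \<in> (\<lambda>a. a *\<^sub>C v p) ` cball 0 1 \<and> y \<in> {\<Sum>i\<in>I. b i *\<^sub>C v i | b. \<forall>i\<in>I. cmod (b i) \<le> 1}}" .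
  moreover have "{x + y |x y. x \<in> (\<lambda>a. a *\<^sub>C v p) ` cball 0 1 \<and> y \<in> {\<Sum>i\<in>I. b i *\<^sub>C v i | b. \<forall>i\<in>I. cmod (b i) \<le> 1}}
      = {\<Sum>i\<in>insert p I. b i *\<^sub>C v i | b. \<forall>i\<in>insert p I. cmod (b i) \<le> 1}" (is "?L = ?R")
  proof
    show "?L \<subseteq> ?R"
    proof
      fix z assume "z \<in> ?L"
      then obtain a b where z: "z = a *\<^sub>C v p + (\<Sum>i\<in>I. b i *\<^sub>C v i)" "cmod a \<le> 1" "\<forall>i\<in>I. cmod (b i) \<le> 1"
        by auto
      have "z = (\<Sum>i\<in>insert p I. (b(p := a)) i *\<^sub>C v i)"
        unfolding sum.insert[OF insert.hyps] z(1)
        using insert.hyps by (auto intro!: sum.cong)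
      then show "z \<in> ?R" using z(2,3) by (intro CollectI exI[of _ "b(p := a)"]) auto
    qed
    show "?R \<subseteq> ?L" using insert.hyps by force
  qed
  ultimately show ?case by simp
qed simp

lemma finite_net:
  fixes S :: "'a::complete_space set"
  assumes "compact (closure S)" "e > 0"
  obtains P where "finite P" "\<And>x. x \<in> S \<Longrightarrow> \<exists>p\<in>P. dist p x < e"
proof -
  obtain P where "finite P" "closure S \<subseteq> (\<Union>x\<in>P. ball x e)"
    using assms unfolding compact_eq_totally_bounded by blast
  then show thesis using closure_subset[of S] by (intro that[of P]) (auto simp: subset_iff)
qed

text \<open>Mazur's theorem by total boundedness. Replacing the points by points of a finite net
  moves a combination by at most \<open>e/3\<close>, since the moduli of the coefficients sum to at
  most 1, and lands in the compact set \<open>Q\<close>. A finite net of \<open>Q\<close> costs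
  another \<open>e/3\<close>, the passage to the closure the last one.\<close>

lemma compact_closure_absconvex_hull:
  fixes S :: "'a::complex_banach set"
  assumes "compact (closure S)"
  shows "compact (closure (absconvex_hull S))"
proof -
  have "\<exists>K. finite K \<and> closure (absconvex_hull S) \<subseteq> (\<Union>x\<in>K. ball x e)" if e: "e > 0" for e
  proof -
    obtain P where P: "finite P" "\<And>x. x \<in> S \<Longrightarrow> \<exists>p\<in>P. dist p x < e/3"
      using finite_net[OF assms, of "e/3"] e by auto
    define Q where "Q = {\<Sum>p\<in>P. b p *\<^sub>C p | b. \<forall>p\<in>P. cmod (b p) \<le> 1}"
    have "compact Q" unfolding Q_def using compact_disc_combinations[OF P(1), of "\<lambda>p. p"] .
    then obtain K where K: "finite K" "\<And>x. x \<in> Q \<Longrightarrow> \<exists>k\<in>K. dist k x < e/3"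
      using finite_net[of Q "e/3"] e by (auto simp: compact_imp_closed)
    have "\<exists>x\<in>K. dist x y < 2*e/3" if yS: "y \<in> absconvex_hull S" for y
    proof -
      obtain n :: nat and a x where y: "y = (\<Sum>i<n. a i *\<^sub>C x i)" "\<forall>i<n. x i \<in> S" "(\<Sum>i<n. cmod (a i)) \<le> 1"
        using yS by (auto simp: absconvex_hull_def)
      have "\<exists>p\<in>P. dist p (x i) < e/3" if "i < n" for i
        using P(2) y(2) that by blast
      then obtain \<pi> where \<pi>: "\<And>i. i < n \<Longrightarrow> \<pi> i \<in> P \<and> dist (\<pi> i) (x i) < e/3" by metis
      define z where "z = (\<Sum>i<n. a i *\<^sub>C \<pi> i)"
      \<comment> \<open>Grouping by net point: the coefficient of \<open>p\<close> collects all
        \<open>a i\<close> whose point was sent to \<open>p\<close>, and its modulus is still at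
        most 1.\<close>
      have "z = (\<Sum>p\<in>P. (\<Sum>i\<in>{i\<in>{..<n}. \<pi> i = p}. a i) *\<^sub>C p)"
      proof -
        have "z = (\<Sum>p\<in>P. \<Sum>i\<in>{i\<in>{..<n}. \<pi> i = p}. a i *\<^sub>C \<pi> i)"
          unfolding z_def by (rule sum.group[symmetric]) (use P \<pi> in auto)
        then show ?thesis by (simp add: scaleC.sum_left)
      qed
      moreover have "cmod (\<Sum>i\<in>{i\<in>{..<n}. \<pi> i = p}. a i) \<le> 1" for p
      proof -
        have "cmod (\<Sum>i\<in>{i\<in>{..<n}. \<pi> i = p}. a i) \<le> (\<Sum>i\<in>{i\<in>{..<n}. \<pi> i = p}. cmod (a i))"
          by (rule norm_sum)
        also have "\<dots> \<le> (\<Sum>i<n. cmod (a i))" by (rule sum_mono2) auto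
        finally show ?thesis using y(3) by simp
      qed
      ultimately have "z \<in> Q"
        unfolding Q_def by (intro CollectI exI[of _ "\<lambda>p. \<Sum>i\<in>{i\<in>{..<n}. \<pi> i = p}. a i"]) auto
      then obtain k where k: "k \<in> K" "dist k z < e/3" using K(2) by blast
      have "dist z y \<le> e/3"
      proof -
        have "norm (z - y) = norm (\<Sum>i<n. a i *\<^sub>C (\<pi> i - x i))"
          by (simp add: z_def y(1) scaleC.diff_right sum_subtractf)
        also have "\<dots> \<le> (\<Sum>i<n. cmod (a i) * (e/3))"
        proof (rule sum_norm_le)
          fix i assume "i \<in> {..<n}"
          then have "norm (\<pi> i - x i) \<le> e/3" using \<pi>[of i] by (simp add: dist_norm)
          then show "norm (a i *\<^sub>C (\<pi> i - x i)) \<le> cmod (a i) * (e/3)"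
            unfolding norm_scaleC by (rule mult_left_mono) simp
        qed
        also have "\<dots> \<le> 1 * (e/3)"
          unfolding sum_distrib_right[symmetric] using y(3) e by (intro mult_right_mono) auto
        finally show ?thesis by (simp add: dist_norm)
      qed
      then have "dist k y < 2*e/3" using k(2) dist_triangle[of k y z] by linarith
      then show ?thesis using k(1) by blast
    qed
    then have "\<exists>x\<in>K. dist x y < e" if yS: "y \<in> closure (absconvex_hull S)" for y
    proof -
      obtain y' where "y' \<in> absconvex_hull S" "dist y' y < e/3"
        using closure_approachableD[OF yS, of "e/3"] e by (auto simp: dist_commute)
      moreover from this obtain x where "x \<in> K" "dist x y' < 2*e/3"
        using \<open>\<And>y. y \<in> absconvex_hull S \<Longrightarrow> \<exists>x\<in>K. dist x y < 2*e/3\<close> by blast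
      ultimately show ?thesis using dist_triangle[of x y y'] by (intro bexI[of _ x]) linarith
    qed
    then show ?thesis using K(1) by (auto intro!: exI[of _ K])
  qed
  then show ?thesis unfolding compact_eq_totally_bounded by (simp add: complete_eq_closed)
qed

section \<open>Almost periodic orbits of isometric flows\<close>

text \<open>The form in which properties pass from the orbit to its closed hull; the instances are
  \<open>continuous_vectors\<close> and \<open>weakly_holomorphic\<close>.\<close>

definition closed_csubspace :: "'a::complex_normed_vector set \<Rightarrow> bool" where
  "closed_csubspace W \<longleftrightarrow> closed W \<and> 0 \<in> W \<and> (\<forall>x\<in>W. \<forall>y\<in>W. x + y \<in> W) \<and> (\<forall>a. \<forall>x\<in>W. a *\<^sub>C x \<in> W)"

lemma closure_absconvex_hull_subset:
  assumes W: "closed_csubspace W" and "S \<subseteq> W"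
  shows "closure (absconvex_hull S) \<subseteq> W"
proof (rule closure_minimal)
  have "(\<Sum>i<n. a i *\<^sub>C x i) \<in> W" if "\<forall>i<n. x i \<in> S" for n :: nat and a x
    using that
  proof (induction n)
    case (Suc n)
    then have "a n *\<^sub>C x n \<in> W" using W \<open>S \<subseteq> W\<close> by (auto simp: closed_csubspace_def)
    moreover have "(\<Sum>i<n. a i *\<^sub>C x i) \<in> W" using Suc by simp
    ultimately show ?case using W by (auto simp: closed_csubspace_def)
  qed (use W in \<open>simp add: closed_csubspace_def\<close>)
  then show "absconvex_hull S \<subseteq> W" by (auto simp: absconvex_hull_def)
qed (use W in \<open>simp add: closed_csubspace_def\<close>)

text \<open>Continuity in \<open>t\<close> is treated as a property of single vectors,
  \<open>continuous_vectors\<close>, because translation is not norm continuous on every bounded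
  continuous function.\<close>

locale isometric_flow =
  fixes U :: "real \<Rightarrow> 'a \<Rightarrow> 'a::complex_banach"
  assumes flow_add: "U t (x + y) = U t x + U t y"
    and flow_scaleC: "U t (a *\<^sub>C x) = a *\<^sub>C U t x"
    and norm_flow: "norm (U t x) = norm x"
    and flow_comp: "U s (U t x) = U (s + t) x"
    and flow_zero [simp]: "U 0 x = x"
begin

lemma flow_diff: "U t (x - y) = U t x - U t y"
  by (metis flow_add add_diff_cancel_right' diff_add_cancel)

lemma flow_sum: "U t (\<Sum>i\<in>I. f i) = (\<Sum>i\<in>I. U t (f i))"
proof (induction I rule: infinite_finite_induct)
  case empty
  show ?case using norm_flow[of t 0] by simp
next
  case (infinite A)
  then show ?case using norm_flow[of t 0] by simp
qed (simp add: flow_add)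

text \<open>Peels off one almost period \<open>t\<close>. With \<open>u = 0\<close> it adds up the
  errors of a sum of almost periods; with \<open>u = s\<close> it compares two samples one period
  apart.\<close>

lemma norm_flow_diff_le: "norm (U (s + t) f - U u f) \<le> norm (U t f - f) + norm (U s f - U u f)"
proof -
  have "U (s + t) f - U u f = U s (U t f - f) + (U s f - U u f)"
    by (simp add: flow_diff flow_comp)
  then show ?thesis using norm_triangle_ineq[of "U s (U t f - f)" "U s f - U u f"] norm_flow by metis
qed

lemma norm_flow_diff: "norm (U s f - U t f) = norm (U (s - t) f - f)"
proof -
  have "U s f - U t f = U t (U (s - t) f - f)" by (simp add: flow_diff flow_comp)
  then show ?thesis by (simp add: norm_flow)
qed

section \<open>Abundance of almost periods\<close>

definition almost_periods :: "'a \<Rightarrow> real \<Rightarrow> nat \<Rightarrow> real \<Rightarrow> nat set" where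
  "almost_periods f h N e = {t. t < N \<and> norm (U (real t * h) f - f) \<le> e}"

text \<open>Pigeonhole: the sample times below \<open>N\<close> are sorted by a nearby point of a
  finite net. Two samples near the same net point are within \<open>e\<close>, so subtracting the
  least time of a class maps it injectively into the almost periods. The number \<open>n\<close> is
  the size of the net, which depends on neither \<open>h\<close> nor \<open>N\<close>.\<close>

lemma almost_periods_dense:
  assumes "compact (closure (range (\<lambda>t. U t f)))" "e > 0"
  shows "\<exists>n. \<forall>h N. N \<le> n * card (almost_periods f h N e)"
proof -
  obtain P where P: "finite P" "\<And>x. x \<in> range (\<lambda>t. U t f) \<Longrightarrow> \<exists>p\<in>P. dist p x < e/2"
    using finite_net[OF assms(1), of "e/2"] assms(2) by auto
  have "\<exists>p\<in>P. dist p (U t f) < e/2" for t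
    using P(2) by blast
  then obtain \<pi> where \<pi>: "\<And>t. \<pi> t \<in> P" "\<And>t. dist (\<pi> t) (U t f) < e/2" by metis
  have "N \<le> card P * card (almost_periods f h N e)" for h N
  proof -
    define F where "F p = {t. t < N \<and> \<pi> (real t * h) = p}" for p
    have "card (F p) \<le> card (almost_periods f h N e)" for p
    proof (cases "F p = {}")
      case False
      have fin: "finite (F p)" by (simp add: F_def)
      define m where "m = Min (F p)"
      have m: "m \<in> F p" and le: "\<And>t. t \<in> F p \<Longrightarrow> m \<le> t"
        using fin False by (auto simp: m_def)
      show ?thesis
      proof (rule card_inj_on_le)
        show "inj_on (\<lambda>t. t - m) (F p)" using le by (auto simp: inj_on_def) (metis le_add_diff_inverse2)
        show "finite (almost_periods f h N e)" by (simp add: almost_periods_def)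
        show "(\<lambda>t. t - m) ` F p \<subseteq> almost_periods f h N e"
        proof safe
          fix t assume t: "t \<in> F p"
          have "dist (U (real t * h) f) (U (real m * h) f) \<le> e"
            using \<pi>(2)[of "real t * h"] \<pi>(2)[of "real m * h"] t m
              dist_triangle3[of "U (real t * h) f" "U (real m * h) f" p] by (auto simp: F_def)
          then show "t - m \<in> almost_periods f h N e"
            using t le[OF t] norm_flow_diff[of "real t * h" f "real m * h"]
            by (auto simp: almost_periods_def F_def dist_norm of_nat_diff left_diff_distrib)
        qed
      qed
    qed simp
    moreover have "{..<N} = (\<Union>p\<in>P. F p)" using \<pi>(1) by (auto simp: F_def)
    then have "N \<le> (\<Sum>p\<in>P. card (F p))" using card_UN_le[OF P(1), of F] by (metis card_lessThan)
    ultimately show ?thesis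
      using sum_bounded_above[of P "\<lambda>p. card (F p)"] by (metis of_nat_id order.trans)
  qed
  then show ?thesis by blast
qed

text \<open>Among the times that are multiples of \<open>L + 1\<close> two share a net point, and
  their difference is a positive multiple of \<open>L + 1\<close>, hence large.\<close>

lemma large_almost_period:
  assumes "compact (closure (range (\<lambda>t. U t f)))" "e > 0"
  shows "\<exists>N\<ge>L. N > 0 \<and> norm (U (real N * h) f - f) \<le> e"
proof -
  define M where "M = Suc L"
  obtain P where P: "finite P" "\<And>x. x \<in> range (\<lambda>t. U t f) \<Longrightarrow> \<exists>p\<in>P. dist p x < e/2"
    using finite_net[OF assms(1), of "e/2"] assms(2) by auto
  have "\<exists>p\<in>P. dist p (U t f) < e/2" for t
    using P(2) by blast
  then obtain \<pi> where \<pi>: "\<And>t. \<pi> t \<in> P" "\<And>t. dist (\<pi> t) (U t f) < e/2" by metis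
  define \<rho> where "\<rho> j = \<pi> (real (j * M) * h)" for j
  have "finite (range \<rho>)" using P(1) \<pi>(1) by (auto simp: \<rho>_def intro: finite_subset[of _ P])
  from pigeonhole_infinite[OF infinite_UNIV_nat this]
  obtain i where i: "infinite {a. \<rho> a = \<rho> i}" by auto
  then obtain j where j: "\<rho> j = \<rho> i" "j > i"
    unfolding infinite_nat_iff_unbounded by (auto dest: spec[of _ i])
  define N where "N = (j - i) * M"
  have "dist (U (real (j * M) * h) f) (U (real (i * M) * h) f) \<le> e"
  proof -
    have "dist (\<rho> a) (U (real (a * M) * h) f) < e/2" for a
      unfolding \<rho>_def by (rule \<pi>(2))
    from this[of i] this[of j] show ?thesis
      using dist_triangle3[of "U (real (j * M) * h) f" "U (real (i * M) * h) f" "\<rho> i"]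
      unfolding j(1) by linarith
  qed
  then have "norm (U (real N * h) f - f) \<le> e"
    using norm_flow_diff[of "real (j * M) * h" f "real (i * M) * h"] j(2)
    by (simp add: dist_norm N_def of_nat_diff algebra_simps)
  moreover have "1 * M \<le> N" unfolding N_def using j(2) by (intro mult_right_mono) auto
  then have "N \<ge> L" "N > 0" by (auto simp: M_def)
  ultimately show ?thesis by blast
qed

text \<open>
  \<open>fourier_coeff\<close> is the discrete Fourier transform on \<open>\<int>/N\<close> of the orbit sampled with step \<open>h\<close> and
  continued \<open>N\<close>-periodically; when \<open>N h\<close> is an almost period the periodic continuation is close to
  the orbit itself.
\<close>

definition fourier_coeff :: "'a \<Rightarrow> real \<Rightarrow> nat \<Rightarrow> nat \<Rightarrow> 'a" where
  "fourier_coeff f h N r = (1 / of_nat N) *\<^sub>C (\<Sum>t<N. cnj (root_char N r t) *\<^sub>C U (real t * h) f)"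

lemma fourier_inversion:
  assumes "s < N"
  shows "(\<Sum>r<N. root_char N r s *\<^sub>C fourier_coeff f h N r) = U (real s * h) f"
proof -
  have "(\<Sum>r<N. root_char N r s *\<^sub>C fourier_coeff f h N r)
      = (\<Sum>r<N. \<Sum>t<N. ((1 / of_nat N) * (root_char N r s * cnj (root_char N r t))) *\<^sub>C U (real t * h) f)"
    by (simp add: fourier_coeff_def scaleC.sum_right scaleC_scaleC mult_ac)
  also have "\<dots> = (\<Sum>t<N. \<Sum>r<N. ((1 / of_nat N) * (root_char N r s * cnj (root_char N r t))) *\<^sub>C U (real t * h) f)"
    by (rule sum.swap)
  also have "\<dots> = (\<Sum>t<N. ((1 / of_nat N) * (\<Sum>r<N. root_char N r s * cnj (root_char N r t))) *\<^sub>C U (real t * h) f)"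
    by (simp add: scaleC.sum_left sum_distrib_left)
  also have "\<dots> = (\<Sum>t<N. if t = s then U (real s * h) f else 0)"
    using assms by (intro sum.cong refl) (simp add: root_char_orthogonal scaleC_one scaleC.zero_left)
  finally show ?thesis using assms by simp
qed

lemma norm_fourier_coeff: "norm (fourier_coeff f h N r) \<le> norm f"
proof (cases "N = 0")
  case False
  have "norm (\<Sum>t<N. cnj (root_char N r t) *\<^sub>C U (real t * h) f) \<le> (\<Sum>t<N. norm f)"
    by (rule sum_norm_le) (simp add: norm_scaleC norm_flow)
  then show ?thesis using False by (simp add: fourier_coeff_def norm_scaleC norm_divide field_simps)
qed (simp add: fourier_coeff_def scaleC.zero_left)

text \<open>A Fourier coefficient is the mean of \<open>N\<close> unimodular multiples of orbit
  points. The factor \<open>w\<close> leaves room for the cubed \<open>char_mean\<close>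
  weights.\<close>

lemma fourier_coeff_in_hull:
  assumes "cmod w \<le> 1"
  shows "w *\<^sub>C fourier_coeff f h N r \<in> absconvex_hull (range (\<lambda>t. U t f))"
proof -
  have "w *\<^sub>C fourier_coeff f h N r
      = (\<Sum>t<N. (w / of_nat N * cnj (root_char N r t)) *\<^sub>C U (real t * h) f)"
    by (simp add: fourier_coeff_def scaleC.sum_right scaleC_scaleC mult_ac)
  moreover have "(\<Sum>t<N. cmod (w / of_nat N * cnj (root_char N r t))) \<le> 1"
    using assms by (cases "N = 0") (auto simp: norm_mult norm_divide)
  ultimately show ?thesis
    unfolding absconvex_hull_def
    by (intro CollectI exI[of _ N] exI[of _ "\<lambda>t. w / of_nat N * cnj (root_char N r t)"]
          exI[of _ "\<lambda>t. U (real t * h) f"]) auto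
qed

text \<open>Moving by \<open>q\<close> steps produces the factor \<open>root_char N r q\<close> and
  shifts the window of summation by \<open>q\<close>. Only boundary terms fail to cancel, and the
  division by \<open>N\<close> makes them small.\<close>

lemma fourier_coeff_almost_eigenvector:
  "norm (U (real q * h) (fourier_coeff f h N r) - root_char N r q *\<^sub>C fourier_coeff f h N r)
    \<le> real q * (2 * norm f) / real N"
proof -
  define a where "a t = cnj (root_char N r t) *\<^sub>C U (real t * h) f" for t
  have "root_char N r q * cnj (root_char N r q) = 1"
    by (simp add: complex_norm_square [symmetric])
  then have rc: "root_char N r q * cnj (root_char N r (t + q)) = cnj (root_char N r t)" for t
    by (simp add: root_char_add)
  have "U (real q * h) (a t) = root_char N r q *\<^sub>C a (t + q)" for t
    by (simp add: a_def flow_scaleC flow_comp scaleC_scaleC rc distrib_right add.commute [of "real q * h"])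
  then have "U (real q * h) (fourier_coeff f h N r) - root_char N r q *\<^sub>C fourier_coeff f h N r
      = (root_char N r q / of_nat N) *\<^sub>C ((\<Sum>t<N. a (t + q)) - (\<Sum>t<N. a t))"
    by (simp add: fourier_coeff_def flow_scaleC flow_sum scaleC_scaleC scaleC.diff_right
        scaleC.sum_right a_def [symmetric])
  moreover have "norm ((\<Sum>t<N. a (t + q)) - (\<Sum>t<N. a t)) \<le> real q * (2 * norm f)"
    by (rule norm_sum_shift_diff) (simp add: a_def norm_scaleC norm_flow)
  ultimately show ?thesis
    by (simp add: norm_scaleC norm_divide divide_right_mono)
qed

text \<open>
  Averaging over sums of three almost periods multiplies the Fourier coefficients by the cube of
  \<open>char_mean\<close>. Parseval bounds the sum of the squares, and the third factor makes the part of the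
  Fourier sum with small \<open>char_mean\<close> small in norm. The number of remaining terms is bounded
  independently of \<open>h\<close> and \<open>N\<close>.
\<close>

lemma fourier_approximation:
  assumes per: "norm (U (real N * h) f - f) \<le> e" and "e \<ge> 0"
    and N: "N \<le> n * card (almost_periods f h N e)" "N > 0" and \<eta>: "\<eta> > 0"
  shows "\<exists>R w. finite R \<and> real (card R) \<le> real n / \<eta>\<^sup>2 \<and> (\<forall>r. cmod (w r) \<le> 1) \<and>
    norm (f - (\<Sum>r\<in>R. w r *\<^sub>C fourier_coeff f h N r)) \<le> 5 * e + \<eta> * real n * norm f"
proof -
  define E where "E = almost_periods f h N e"
  define w where "w = char_mean N E"
  define c where "c = fourier_coeff f h N"
  have E: "E \<subseteq> {..<N}" "finite E" by (auto simp: E_def almost_periods_def)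
  have ne: "E \<noteq> {}" and cE: "card E > 0" using N E by (auto simp: E_def intro: Nat.gr0I)
  define g where "g s = U (real (s mod N) * h) f" for s
  have g: "(\<Sum>r<N. root_char N r s *\<^sub>C c r) = g s" for s
    using fourier_inversion[of "s mod N" N f h] N(2) by (simp add: c_def g_def root_char_mod)
  \<comment> \<open>The three almost periods cost \<open>3 * e\<close>. Their sum is below
    \<open>3 * N\<close>, so reduction modulo \<open>N\<close> subtracts \<open>N\<close> at most
    twice, at a cost of \<open>e\<close> each time.\<close>
  have g_near: "norm (g (x + y + z) - f) \<le> 5 * e" if "x \<in> E" "y \<in> E" "z \<in> E" for x y z
  proof -
    have U3: "norm (U (real (x + y + z) * h) f - f) \<le> 3 * e"
    proof -
      have "norm (U (real (x + y + z) * h) f - U 0 f)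
          \<le> norm (U (real z * h) f - f) + norm (U (real (x + y) * h) f - U 0 f)"
        using norm_flow_diff_le[of "real (x + y) * h" "real z * h" f 0] by (simp add: algebra_simps)
      moreover have "norm (U (real (x + y) * h) f - U 0 f)
          \<le> norm (U (real y * h) f - f) + norm (U (real x * h) f - U 0 f)"
        using norm_flow_diff_le[of "real x * h" "real y * h" f 0] by (simp add: algebra_simps)
      ultimately show ?thesis using that by (auto simp: E_def almost_periods_def)
    qed
    have wrap: "norm (U (real (i + N) * h) f - U (real i * h) f) \<le> e" for i
      using norm_flow_diff_le[of "real i * h" "real N * h" f "real i * h"] per by (simp add: algebra_simps)
    define s where "s = x + y + z"
    have "x < N" "y < N" "z < N" using that E by auto
    then have "s < 3 * N" by (simp add: s_def)
    then consider "s < N" | "N \<le> s" "s < 2 * N" | "2 * N \<le> s" "s < 3 * N" by linarith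
    then have "norm (g s - U (real s * h) f) \<le> 2 * e"
    proof cases
      case 1
      then show ?thesis using \<open>e \<ge> 0\<close> by (simp add: g_def)
    next
      case 2
      then have "s mod N = s - N" by (simp add: mod_if)
      then show ?thesis using wrap[of "s - N"] 2 \<open>e \<ge> 0\<close> by (simp add: g_def norm_minus_commute)
    next
      case 3
      then have "s mod N = s - N - N" by (simp add: mod_if)
      moreover have "norm (U (real (s - N - N) * h) f - U (real s * h) f) \<le> e + e"
        using wrap[of "s - N - N"] wrap[of "s - N"] 3
        by (intro norm_diff_triangle_le[where y = "U (real (s - N) * h) f"])
          (auto simp: norm_minus_commute)
      ultimately show ?thesis by (simp add: g_def)
    qed
    then show ?thesis
      using U3 norm_diff_triangle_le[of "g s" "U (real s * h) f" "2 * e" f "3 * e"]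
      by (simp add: s_def)
  qed
  have w3: "w r ^ 3 = (1 / of_nat (card E) ^ 3) * (\<Sum>x\<in>E. \<Sum>y\<in>E. \<Sum>z\<in>E. root_char N r (x + y + z))" for r
  proof -
    have "(\<Sum>x\<in>E. root_char N r x) ^ 3 = (\<Sum>x\<in>E. \<Sum>y\<in>E. \<Sum>z\<in>E. root_char N r (x + y + z))"
    proof -
      have "(\<Sum>x\<in>E. root_char N r x) ^ 3
          = (\<Sum>x\<in>E. root_char N r x * (\<Sum>y\<in>E. root_char N r y * (\<Sum>z\<in>E. root_char N r z)))"
        by (simp add: power3_eq_cube mult.assoc sum_distrib_right [symmetric])
      then show ?thesis by (simp add: sum_distrib_left root_char_add mult.assoc)
    qed
    then show ?thesis by (simp add: w_def char_mean_def power_divide)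
  qed
  have "(\<Sum>r<N. w r ^ 3 *\<^sub>C c r)
      = (\<Sum>r<N. (1 / of_nat (card E) ^ 3) *\<^sub>C (\<Sum>x\<in>E. \<Sum>y\<in>E. \<Sum>z\<in>E. root_char N r (x + y + z) *\<^sub>C c r))"
    by (simp only: w3 scaleC_scaleC [symmetric] scaleC.sum_left)
  also have "\<dots> = (1 / of_nat (card E) ^ 3) *\<^sub>C (\<Sum>x\<in>E. \<Sum>y\<in>E. \<Sum>z\<in>E. \<Sum>r<N. root_char N r (x + y + z) *\<^sub>C c r)"
    by (simp only: scaleC.sum_right [symmetric] sum.swap[where A = E and B = "{..<N}"])
  also have "\<dots> = (1 / of_nat (card E) ^ 3) *\<^sub>C (\<Sum>x\<in>E. \<Sum>y\<in>E. \<Sum>z\<in>E. g (x + y + z))"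
    by (simp only: g)
  finally have avg: "(\<Sum>r<N. w r ^ 3 *\<^sub>C c r)
      = (1 / of_nat (card E) ^ 3) *\<^sub>C (\<Sum>x\<in>E. \<Sum>y\<in>E. \<Sum>z\<in>E. g (x + y + z))" .
  have total: "(\<Sum>r<N. w r ^ 3 *\<^sub>C c r) - f
      = (1 / of_nat (card E) ^ 3) *\<^sub>C (\<Sum>x\<in>E. \<Sum>y\<in>E. \<Sum>z\<in>E. g (x + y + z) - f)"
  proof -
    have "(\<Sum>x\<in>E. \<Sum>y\<in>E. \<Sum>z\<in>E. f) = (of_nat (card E) ^ 3) *\<^sub>C f"
      by (simp add: sum_constant_scaleR scaleR_scaleC scaleC_scaleC power3_eq_cube mult.assoc)
    then have "(1 / of_nat (card E) ^ 3) *\<^sub>C (\<Sum>x\<in>E. \<Sum>y\<in>E. \<Sum>z\<in>E. f) = f"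
      using cE by (simp add: scaleC_scaleC scaleC_one)
    then show ?thesis unfolding avg by (simp add: sum_subtractf scaleC.diff_right)
  qed
  have "norm (\<Sum>x\<in>E. \<Sum>y\<in>E. \<Sum>z\<in>E. g (x + y + z) - f) \<le> (\<Sum>x\<in>E. \<Sum>y\<in>E. \<Sum>z\<in>E. 5 * e)"
    by (intro sum_norm_le g_near)
  also have "\<dots> = real (card E) ^ 3 * (5 * e)" by (simp add: power3_eq_cube)
  finally have total_le: "norm ((\<Sum>r<N. w r ^ 3 *\<^sub>C c r) - f) \<le> 5 * e"
    unfolding total norm_scaleC using cE
    by (simp add: norm_divide norm_power pos_divide_le_eq mult.commute)
  have Parseval: "(\<Sum>r<N. (cmod (w r))\<^sup>2) \<le> real n"
  proof -
    have "real N \<le> real n * real (card E)"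
      using N(1) unfolding E_def by (metis of_nat_le_iff of_nat_mult)
    then have "real N / real (card E) \<le> real n" using cE by (simp add: pos_divide_le_eq)
    then show ?thesis by (simp add: w_def char_mean_Parseval[OF E(1) ne])
  qed
  \<comment> \<open>The frequencies kept; Chebyshev's inequality and Parseval bound their number by
    \<open>real n / \<eta>\<^sup>2\<close>.\<close>
  define R where "R = {r. r < N \<and> \<eta> \<le> cmod (w r)}"
  have R: "R \<subseteq> {..<N}" by (auto simp: R_def)
  have "real (card R) * \<eta>\<^sup>2 = (\<Sum>r\<in>R. \<eta>\<^sup>2)" by simp
  also have "\<dots> \<le> (\<Sum>r\<in>R. (cmod (w r))\<^sup>2)"
    using \<eta> by (intro sum_mono power_mono) (auto simp: R_def)
  also have "\<dots> \<le> (\<Sum>r<N. (cmod (w r))\<^sup>2)" using R by (intro sum_mono2) auto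
  finally have card: "real (card R) \<le> real n / \<eta>\<^sup>2"
    using Parseval \<eta> by (simp add: field_simps)
  have "norm (\<Sum>r\<in>{..<N} - R. w r ^ 3 *\<^sub>C c r) \<le> (\<Sum>r\<in>{..<N} - R. \<eta> * norm f * (cmod (w r))\<^sup>2)"
  proof (rule sum_norm_le)
    fix r assume r: "r \<in> {..<N} - R"
    have "norm (w r ^ 3 *\<^sub>C c r) = cmod (w r) * norm (c r) * (cmod (w r))\<^sup>2"
      by (simp add: norm_scaleC norm_mult power3_eq_cube power2_eq_square)
    also have "\<dots> \<le> \<eta> * norm f * (cmod (w r))\<^sup>2"
      using r norm_fourier_coeff[of f h N r] \<eta>
      by (intro mult_right_mono mult_mono) (auto simp: R_def c_def)
    finally show "norm (w r ^ 3 *\<^sub>C c r) \<le> \<eta> * norm f * (cmod (w r))\<^sup>2" .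
  qed
  also have "\<dots> \<le> (\<Sum>r<N. \<eta> * norm f * (cmod (w r))\<^sup>2)"
    using \<eta> by (intro sum_mono2) auto
  also have "\<dots> \<le> \<eta> * norm f * real n"
    unfolding sum_distrib_left[symmetric] using Parseval \<eta> by (intro mult_left_mono) auto
  finally have small: "norm (\<Sum>r\<in>{..<N} - R. w r ^ 3 *\<^sub>C c r) \<le> \<eta> * real n * norm f"
    by (simp add: mult_ac)
  have "(\<Sum>r<N. w r ^ 3 *\<^sub>C c r) = (\<Sum>r\<in>{..<N} - R. w r ^ 3 *\<^sub>C c r) + (\<Sum>r\<in>R. w r ^ 3 *\<^sub>C c r)"
    by (rule sum.subset_diff[OF R]) simp
  then have "f - (\<Sum>r\<in>R. w r ^ 3 *\<^sub>C c r)
      = (\<Sum>r\<in>{..<N} - R. w r ^ 3 *\<^sub>C c r) - ((\<Sum>r<N. w r ^ 3 *\<^sub>C c r) - f)"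
    by simp
  then have "norm (f - (\<Sum>r\<in>R. w r ^ 3 *\<^sub>C c r)) \<le> 5 * e + \<eta> * real n * norm f"
    using small total_le norm_triangle_ineq4 by (smt (verit))
  moreover have "cmod (w r ^ 3) \<le> 1" for r
    using norm_char_mean[of N E r] by (simp add: w_def norm_power power_le_one)
  ultimately show ?thesis
    using card R finite_subset[OF R] unfolding c_def
    by (intro exI[of _ R] exI[of _ "\<lambda>r. w r ^ 3"]) auto
qed

text \<open>The multiplier may depend on \<open>t\<close> in any way, and the zero vector is
  included; for holomorphic vectors the form of the multiplier comes out in
  \<open>eigenvector_eq_exp\<close>.\<close>

definition eigenvectors :: "'a set" where
  "eigenvectors = {c. \<forall>t. \<exists>\<zeta>. cmod \<zeta> = 1 \<and> U t c = \<zeta> *\<^sub>C c}"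

text \<open>
  The error is that of \<open>fourier_coeff_almost_eigenvector\<close> for step \<open>1/(k+1)\<close> and period
  \<open>N \<ge> (k+1)\<^sup>2\<close>; it tends to \<open>0\<close> as long as \<open>q/(k+1)\<close> stays bounded.
\<close>

definition almost_eigenvectors :: "real \<Rightarrow> nat \<Rightarrow> 'a set" where
  "almost_eigenvectors B k = {c. \<forall>q. \<exists>\<zeta>. cmod \<zeta> = 1 \<and>
     norm (U (real q / real (Suc k)) c - \<zeta> *\<^sub>C c) \<le> real q * B / (real (Suc k))\<^sup>2}"

definition continuous_vectors :: "'a set" where
  "continuous_vectors = {c. ((\<lambda>t. U t c) \<longlongrightarrow> c) (at 0)}"

text \<open>Closedness is a three-epsilon argument: isometries are equicontinuous, so one nearby
  continuous vector controls all \<open>U t l\<close> at once.\<close>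

lemma closed_csubspace_continuous_vectors: "closed_csubspace continuous_vectors"
  unfolding closed_csubspace_def
proof (intro conjI ballI allI)
  show "closed continuous_vectors"
    unfolding closed_sequential_limits
  proof (intro allI impI, elim conjE)
    fix x l assume x: "\<forall>n. x n \<in> continuous_vectors" and l: "x \<longlonglongrightarrow> l"
    have "((\<lambda>t. U t l) \<longlongrightarrow> l) (at 0)"
    proof (rule tendstoI)
      fix e :: real assume e: "e > 0"
      then obtain n where n: "norm (x n - l) < e/3"
        using l unfolding LIMSEQ_iff by (metis order_refl zero_less_divide_iff zero_less_numeral)
      have "((\<lambda>t. U t (x n)) \<longlongrightarrow> x n) (at 0)" using x by (simp add: continuous_vectors_def)
      then have "\<forall>\<^sub>F t in at 0. dist (U t (x n)) (x n) < e/3" using e by (intro tendstoD) auto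
      then show "\<forall>\<^sub>F t in at 0. dist (U t l) l < e"
      proof eventually_elim
        case (elim t)
        have "norm (U t l - U t (x n)) < e/3"
          using n norm_flow[of t "l - x n"] by (simp add: flow_diff norm_minus_commute)
        then show ?case using elim n norm_triangle_ineq[of "U t l - U t (x n)" "(U t (x n) - x n) + (x n - l)"]
            norm_triangle_ineq[of "U t (x n) - x n" "x n - l"] by (simp add: dist_norm)
      qed
    qed
    then show "l \<in> continuous_vectors" by (simp add: continuous_vectors_def)
  qed
  show "0 \<in> continuous_vectors" using norm_flow[of _ 0] by (simp add: continuous_vectors_def)
qed (auto simp: continuous_vectors_def flow_add flow_scaleC intro: tendsto_add scaleC.tendsto tendsto_const)

text \<open>Isometry handles the change of the vector, and the group law moves the change of time to
  a neighbourhood of 0.\<close>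

lemma tendsto_flow:
  assumes c: "c \<in> continuous_vectors" and x: "x \<longlonglongrightarrow> c" and s: "s \<longlonglongrightarrow> t"
  shows "(\<lambda>n. U (s n) (x n)) \<longlonglongrightarrow> U t c"
proof -
  have "isCont (\<lambda>t. U t c) 0" using c by (simp add: continuous_vectors_def isCont_def)
  moreover have "(\<lambda>n. s n - t) \<longlonglongrightarrow> 0" using s by (simp add: LIM_zero)
  ultimately have "(\<lambda>n. U (s n - t) c) \<longlonglongrightarrow> U 0 c" by (rule isCont_tendsto_compose)
  then have "(\<lambda>n. norm (U (s n - t) c - c)) \<longlonglongrightarrow> 0" by (simp add: tendsto_norm_zero LIM_zero)
  moreover have "(\<lambda>n. norm (x n - c)) \<longlonglongrightarrow> 0" using x by (simp add: tendsto_norm_zero LIM_zero)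
  ultimately have "(\<lambda>n. norm (x n - c) + norm (U (s n - t) c - c)) \<longlonglongrightarrow> 0"
    using tendsto_add_zero by blast
  moreover have "norm (U (s n) (x n) - U t c) \<le> norm (x n - c) + norm (U (s n - t) c - c)" for n
    using norm_triangle_ineq[of "U (s n) (x n - c)" "U (s n) c - U t c"]
    by (simp add: norm_flow flow_diff [symmetric] norm_flow_diff) (simp add: flow_diff)
  ultimately have "(\<lambda>n. U (s n) (x n) - U t c) \<longlonglongrightarrow> 0"
    by (intro Lim_null_comparison[of "\<lambda>n. U (s n) (x n) - U t c" "\<lambda>n. norm (x n - c) + norm (U (s n - t) c - c)"]) auto
  then show ?thesis by (rule LIM_zero_cancel)
qed

text \<open>By contradiction: almost eigenvectors that stay \<delta>-far from the eigenvectors in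
  \<open>D\<close> would, by compactness, accumulate at some \<open>c\<close> in \<open>D\<close>,
  and the limit of the defining inequalities makes \<open>c\<close> an eigenvector.\<close>

lemma almost_eigenvectors_near_eigenvectors:
  assumes D: "compact D" "D \<subseteq> continuous_vectors" and \<delta>: "\<delta> > 0"
  shows "\<exists>k. \<forall>c \<in> D \<inter> almost_eigenvectors B k. \<exists>c' \<in> D \<inter> eigenvectors. norm (c - c') < \<delta>"
proof (rule ccontr)
  assume "\<not> ?thesis"
  then obtain x where x: "\<And>k. x k \<in> D" "\<And>k. x k \<in> almost_eigenvectors B k"
    and far: "\<And>k c'. c' \<in> D \<inter> eigenvectors \<Longrightarrow> norm (x k - c') \<ge> \<delta>"
    by (metis Int_iff not_less)
  obtain c \<rho> where c: "c \<in> D" "strict_mono \<rho>" "(x \<circ> \<rho>) \<longlonglongrightarrow> c"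
    using D(1) x(1) unfolding compact_eq_seq_compact_metric seq_compact_def by metis
  \<comment> \<open>A limit of unimodular multiples of \<open>c\<close> is again one, so convergence
    of the multipliers themselves need not be arranged.\<close>
  have circle: "closed ((\<lambda>\<zeta>. \<zeta> *\<^sub>C c) ` sphere 0 1)"
    by (intro compact_imp_closed compact_continuous_image continuous_intros scaleC.continuous_on) auto
  have pos: "\<exists>\<zeta>. cmod \<zeta> = 1 \<and> U t c = \<zeta> *\<^sub>C c" if t: "t \<ge> 0" for t
  proof -
    \<comment> \<open>The last grid point not after \<open>t\<close>; as the grid is refined these
      points tend to \<open>t\<close>. The grid has no negative times, which are recovered below by
      inverting the flow.\<close>
    define q where "q n = nat \<lfloor>t * real (Suc (\<rho> n))\<rfloor>" for n
    have lim_\<rho>: "filterlim (\<lambda>n. real (Suc (\<rho> n))) at_top sequentially"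
      using filterlim_compose[OF filterlim_real_sequentially filterlim_compose[OF filterlim_Suc filterlim_subseq[OF c(2)]]]
      by (simp add: o_def)
    have inv: "(\<lambda>n. 1 / real (Suc (\<rho> n))) \<longlonglongrightarrow> 0"
      by (rule real_tendsto_divide_at_top[OF tendsto_const lim_\<rho>])
    have q: "real (q n) \<le> t * real (Suc (\<rho> n))" "t * real (Suc (\<rho> n)) - 1 \<le> real (q n)" for n
      using t unfolding q_def by (auto simp: of_nat_nat)
    have qlim: "(\<lambda>n. real (q n) / real (Suc (\<rho> n))) \<longlonglongrightarrow> t"
    proof (rule tendsto_sandwich[of "\<lambda>n. t - 1 / real (Suc (\<rho> n))" _ _ "\<lambda>n. t"])
      show "(\<lambda>n. t - 1 / real (Suc (\<rho> n))) \<longlonglongrightarrow> t"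
        using tendsto_diff[OF tendsto_const inv, of t] by simp
      have "t - 1 / real (Suc (\<rho> n)) \<le> real (q n) / real (Suc (\<rho> n))" for n
        using divide_right_mono[OF q(2)[of n], of "real (Suc (\<rho> n))"]
        by (simp add: diff_divide_distrib del: of_nat_Suc)
      then show "\<forall>\<^sub>F n in sequentially. t - 1 / real (Suc (\<rho> n)) \<le> real (q n) / real (Suc (\<rho> n))"
        by (intro always_eventually allI)
      show "\<forall>\<^sub>F n in sequentially. real (q n) / real (Suc (\<rho> n)) \<le> t"
        using q(1) by (intro always_eventually allI) (simp add: pos_divide_le_eq del: of_nat_Suc)
    qed simp
    have "\<exists>\<zeta>. cmod \<zeta> = 1 \<and> norm (U (real (q n) / real (Suc (\<rho> n))) (x (\<rho> n)) - \<zeta> *\<^sub>C x (\<rho> n))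
        \<le> real (q n) * B / (real (Suc (\<rho> n)))\<^sup>2" for n
      using x(2)[of "\<rho> n"] unfolding almost_eigenvectors_def by blast
    then obtain \<zeta> where \<zeta>: "\<And>n. cmod (\<zeta> n) = 1"
      and ae: "\<And>n. norm (U (real (q n) / real (Suc (\<rho> n))) (x (\<rho> n)) - \<zeta> n *\<^sub>C x (\<rho> n))
        \<le> real (q n) * B / (real (Suc (\<rho> n)))\<^sup>2" by metis
    have Ulim: "(\<lambda>n. U (real (q n) / real (Suc (\<rho> n))) (x (\<rho> n))) \<longlonglongrightarrow> U t c"
      using c D(2) qlim by (intro tendsto_flow) (auto simp: o_def)
    have "(\<lambda>n. (real (q n) / real (Suc (\<rho> n))) * B * (1 / real (Suc (\<rho> n)))) \<longlonglongrightarrow> t * B * 0"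
      by (intro tendsto_intros qlim inv)
    then have "(\<lambda>n. real (q n) * B / (real (Suc (\<rho> n)))\<^sup>2) \<longlonglongrightarrow> 0"
      by (simp add: power2_eq_square)
    then have "(\<lambda>n. U (real (q n) / real (Suc (\<rho> n))) (x (\<rho> n)) - \<zeta> n *\<^sub>C x (\<rho> n)) \<longlonglongrightarrow> 0"
      by (rule Lim_null_comparison[OF always_eventually, rotated]) (use ae in blast)
    from tendsto_diff[OF Ulim this] have 1: "(\<lambda>n. \<zeta> n *\<^sub>C x (\<rho> n)) \<longlonglongrightarrow> U t c" by simp
    have "(\<lambda>n. norm (x (\<rho> n) - c)) \<longlonglongrightarrow> 0"
      using c(3) by (simp add: tendsto_norm_zero LIM_zero o_def)
    then have "(\<lambda>n. \<zeta> n *\<^sub>C x (\<rho> n) - \<zeta> n *\<^sub>C c) \<longlonglongrightarrow> 0"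
      by (rule Lim_null_comparison[OF always_eventually, rotated])
        (simp add: scaleC.diff_right [symmetric] norm_scaleC \<zeta>)
    from tendsto_diff[OF 1 this] have "(\<lambda>n. \<zeta> n *\<^sub>C c) \<longlonglongrightarrow> U t c" by simp
    then have "U t c \<in> (\<lambda>\<zeta>. \<zeta> *\<^sub>C c) ` sphere 0 1"
      by (rule closed_sequentially[OF circle, rotated]) (use \<zeta> in auto)
    then show ?thesis by auto
  qed
  have "c \<in> eigenvectors"
    unfolding eigenvectors_def
  proof (intro CollectI allI)
    fix t
    show "\<exists>\<zeta>. cmod \<zeta> = 1 \<and> U t c = \<zeta> *\<^sub>C c"
    proof (cases "t \<ge> 0")
      case False
      then obtain \<zeta> where z: "cmod \<zeta> = 1" "U (- t) c = \<zeta> *\<^sub>C c" using pos[of "- t"] by auto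
      have "U t (U (- t) c) = c" by (simp add: flow_comp)
      then have "\<zeta> *\<^sub>C U t c = c" by (simp add: z(2) flow_scaleC)
      then have "inverse \<zeta> *\<^sub>C \<zeta> *\<^sub>C U t c = inverse \<zeta> *\<^sub>C c" by simp
      moreover have "\<zeta> \<noteq> 0" using z(1) by auto
      ultimately have "U t c = inverse \<zeta> *\<^sub>C c" by (simp add: scaleC_scaleC scaleC_one)
      then show ?thesis using z(1) by (intro exI[of _ "inverse \<zeta>"]) (simp add: norm_inverse)
    qed (rule pos)
  qed
  moreover obtain n where "norm ((x \<circ> \<rho>) n - c) < \<delta>"
    using c(3) \<delta> unfolding LIMSEQ_iff by blast
  ultimately show False using far[of c "\<rho> n"] c(1) by simp
qed

theorem eigenvector_approximation:
  assumes cpt: "compact (closure (range (\<lambda>t. U t f)))" and cont: "((\<lambda>t. U t f) \<longlongrightarrow> f) (at 0)"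
    and W: "closed_csubspace W" "range (\<lambda>t. U t f) \<subseteq> W" and \<epsilon>: "\<epsilon> > 0"
  shows "\<exists>(R::nat set) c. finite R \<and> (\<forall>r\<in>R. c r \<in> W \<inter> eigenvectors) \<and> norm (f - (\<Sum>r\<in>R. c r)) < \<epsilon>"
proof -
  define D where "D = closure (absconvex_hull (range (\<lambda>t. U t f)))"
  have D: "compact D" unfolding D_def by (rule compact_closure_absconvex_hull[OF cpt])
  have DW: "D \<subseteq> W" unfolding D_def by (rule closure_absconvex_hull_subset[OF W])
  have "U s f \<in> continuous_vectors" for s
  proof -
    have "((\<lambda>t. norm (U t f - f)) \<longlongrightarrow> 0) (at 0)"
      using cont by (simp add: tendsto_norm_zero LIM_zero)
    moreover have "norm (U t (U s f) - U s f) = norm (U t f - f)" for t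
      by (simp add: flow_comp norm_flow_diff)
    ultimately have "((\<lambda>t. norm (U t (U s f) - U s f)) \<longlongrightarrow> 0) (at 0)" by simp
    then have "((\<lambda>t. U t (U s f) - U s f) \<longlongrightarrow> 0) (at 0)"
      by (rule tendsto_norm_zero_cancel)
    then show ?thesis by (simp add: continuous_vectors_def LIM_zero_iff)
  qed
  then have DC: "D \<subseteq> continuous_vectors"
    unfolding D_def by (intro closure_absconvex_hull_subset closed_csubspace_continuous_vectors) auto
  \<comment> \<open>Three errors of \<epsilon>/4 are planned: \<open>5 * e\<close> from averaging,
    \<open>\<eta> * real n * norm f\<close> from the frequencies left out, and
    \<open>b * \<delta>\<close> from replacing the terms by eigenvectors.\<close>
  define e where "e = \<epsilon> / 20"
  have e: "e > 0" using \<epsilon> by (simp add: e_def)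
  obtain n where n: "\<And>h N. N \<le> n * card (almost_periods f h N e)"
    using almost_periods_dense[OF cpt e] by blast
  \<comment> \<open>The summand 1, here and in \<open>b\<close>, keeps the denominators of \<eta>
    and \<delta> positive when \<open>f = 0\<close> or \<open>n = 0\<close>.\<close>
  define a where "a = real n * norm f + 1"
  have a: "a > 0" unfolding a_def by (smt (verit) mult_nonneg_nonneg norm_ge_zero of_nat_0_le_iff)
  define \<eta> where "\<eta> = \<epsilon> / (4 * a)"
  have \<eta>: "\<eta> > 0" using \<epsilon> a by (simp add: \<eta>_def)
  have "\<eta> * a = \<epsilon> / 4" using a by (simp add: \<eta>_def)
  then have \<eta>_le: "\<eta> * real n * norm f \<le> \<epsilon> / 4" using \<eta> by (simp add: a_def algebra_simps)
  define b where "b = real n / \<eta>\<^sup>2 + 1"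
  have b: "b > 0" unfolding b_def by (smt (verit) divide_nonneg_nonneg of_nat_0_le_iff zero_le_power2)
  define \<delta> where "\<delta> = \<epsilon> / (4 * b)"
  have \<delta>: "\<delta> > 0" using \<epsilon> b by (simp add: \<delta>_def)
  have \<delta>_eq: "b * \<delta> = \<epsilon> / 4" using b by (simp add: \<delta>_def)
  obtain k where k: "\<And>c. c \<in> D \<inter> almost_eigenvectors (2 * norm f) k \<Longrightarrow>
      \<exists>c' \<in> D \<inter> eigenvectors. norm (c - c') < \<delta>"
    using almost_eigenvectors_near_eigenvectors[OF D DC \<delta>] by blast
  define h where "h = 1 / real (Suc k)"
  obtain N where N: "N \<ge> (Suc k)\<^sup>2" "N > 0" "norm (U (real N * h) f - f) \<le> e"
    using large_almost_period[OF cpt e] by blast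
  obtain R w where R: "finite R" "real (card R) \<le> real n / \<eta>\<^sup>2" and w: "\<And>r. cmod (w r) \<le> 1"
    and approx: "norm (f - (\<Sum>r\<in>R. w r *\<^sub>C fourier_coeff f h N r)) \<le> 5 * e + \<eta> * real n * norm f"
    using fourier_approximation[OF N(3) less_imp_le[OF e] n N(2) \<eta>] by blast
  define c where "c r = w r *\<^sub>C fourier_coeff f h N r" for r
  have "c r \<in> D \<inter> almost_eigenvectors (2 * norm f) k" for r
  proof
    show "c r \<in> D"
      using fourier_coeff_in_hull[OF w] closure_subset unfolding c_def D_def by blast
    have "norm (U (real q / real (Suc k)) (c r) - root_char N r q *\<^sub>C c r)
        \<le> real q * (2 * norm f) / (real (Suc k))\<^sup>2" for q
    proof -
      have "U (real q * h) (c r) - root_char N r q *\<^sub>C c r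
          = w r *\<^sub>C (U (real q * h) (fourier_coeff f h N r) - root_char N r q *\<^sub>C fourier_coeff f h N r)"
        by (simp add: c_def flow_scaleC scaleC.diff_right scaleC_scaleC mult.commute)
      then have "norm (U (real q * h) (c r) - root_char N r q *\<^sub>C c r)
          \<le> 1 * (real q * (2 * norm f) / real N)"
        unfolding norm_scaleC using w fourier_coeff_almost_eigenvector by (simp only: norm_scaleC) (intro mult_mono, auto)
      also have "\<dots> \<le> real q * (2 * norm f) / (real (Suc k))\<^sup>2"
      proof -
        have "(real (Suc k))\<^sup>2 \<le> real N" using N(1) by (metis of_nat_le_iff of_nat_power)
        then show ?thesis unfolding mult_1 by (intro divide_left_mono) (use N(2) in auto)
      qed
      finally show ?thesis by (simp add: h_def)
    qed
    then show "c r \<in> almost_eigenvectors (2 * norm f) k"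
      unfolding almost_eigenvectors_def by (intro CollectI allI exI[of _ "root_char N r _"]) simp
  qed
  then have "\<forall>r. \<exists>c'\<in>D \<inter> eigenvectors. norm (c r - c') < \<delta>" using k by blast
  then obtain c' where c': "\<And>r. c' r \<in> D \<inter> eigenvectors" "\<And>r. norm (c r - c' r) < \<delta>" by metis
  have "norm ((\<Sum>r\<in>R. c r) - (\<Sum>r\<in>R. c' r)) \<le> (\<Sum>r\<in>R. \<delta>)"
    unfolding sum_subtractf[symmetric] by (intro sum_norm_le less_imp_le c'(2))
  also have "\<dots> \<le> b * \<delta>" using R \<delta> by (simp add: b_def mult_right_mono)
  finally have "norm ((\<Sum>r\<in>R. c r) - (\<Sum>r\<in>R. c' r)) \<le> \<epsilon> / 4" using \<delta>_eq by simp
  moreover have "norm (f - (\<Sum>r\<in>R. c r)) \<le> \<epsilon> / 4 + \<epsilon> / 4"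
    using approx \<eta>_le unfolding c_def e_def by simp
  ultimately have "norm (f - (\<Sum>r\<in>R. c' r)) < \<epsilon>"
    using norm_diff_triangle_le[of f "\<Sum>r\<in>R. c r" "\<epsilon>/4 + \<epsilon>/4" "\<Sum>r\<in>R. c' r" "\<epsilon>/4"] \<epsilon> by simp
  then show ?thesis using R(1) c'(1) DW by (intro exI[of _ R] exI[of _ c']) auto
qed

end

section \<open>Translations of functions on the strip\<close>

instantiation bcontfun :: (topological_space, complex_normed_vector) complex_normed_vector
begin

definition scaleC_bcontfun :: "complex \<Rightarrow> ('a, 'b) bcontfun \<Rightarrow> ('a, 'b) bcontfun" where
  "scaleC_bcontfun a f = Bcontfun (\<lambda>x. a *\<^sub>C apply_bcontfun f x)"

lemma apply_scaleC_bcontfun: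
  "apply_bcontfun (a *\<^sub>C f) x = a *\<^sub>C apply_bcontfun f x" for f :: "('a, 'b) bcontfun"
proof -
  have "(\<lambda>x. a *\<^sub>C apply_bcontfun f x) \<in> bcontfun"
  proof (rule bcontfun_normI)
    show "continuous_on UNIV (\<lambda>x. a *\<^sub>C apply_bcontfun f x)"
      by (intro scaleC.continuous_on continuous_intros) simp
    show "norm (a *\<^sub>C apply_bcontfun f x) \<le> cmod a * norm f" for x
      by (simp add: norm_scaleC norm_bounded mult_left_mono)
  qed
  then show ?thesis by (simp add: scaleC_bcontfun_def Bcontfun_inverse)
qed

instance
proof
  fix a b :: complex and r :: real and f g :: "('a, 'b) bcontfun"
  note [simp] = apply_scaleC_bcontfun
  show "a *\<^sub>C (f + g) = a *\<^sub>C f + a *\<^sub>C g"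
    by (rule bcontfun_eqI) (simp add: scaleC_add_right)
  show "(a + b) *\<^sub>C f = a *\<^sub>C f + b *\<^sub>C f"
    by (rule bcontfun_eqI) (simp add: scaleC_add_left)
  show assoc: "a *\<^sub>C b *\<^sub>C f = (a * b) *\<^sub>C f" for a b and f :: "('a, 'b) bcontfun"
    by (rule bcontfun_eqI) (simp add: scaleC_scaleC)
  show one: "1 *\<^sub>C f = f" for f :: "('a, 'b) bcontfun"
    by (rule bcontfun_eqI) (simp add: scaleC_one)
  show "r *\<^sub>R f = complex_of_real r *\<^sub>C f"
    by (rule bcontfun_eqI) (simp add: scaleR_scaleC)
  have le: "norm (a *\<^sub>C f) \<le> cmod a * norm f" for a and f :: "('a, 'b) bcontfun"
    by (rule norm_bound) (simp add: norm_scaleC norm_bounded mult_left_mono)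
  show "norm (a *\<^sub>C f) = cmod a * norm f"
  proof (cases "a = 0")
    case True
    then show ?thesis using le[of 0 f] by simp
  next
    case False
    have "norm (inverse a *\<^sub>C a *\<^sub>C f) \<le> cmod (inverse a) * norm (a *\<^sub>C f)" by (rule le)
    then have "cmod a * norm f \<le> norm (a *\<^sub>C f)"
      using False by (simp add: assoc one norm_inverse) (simp add: field_simps)
    then show ?thesis using le[of a f] by linarith
  qed
qed

end

instance bcontfun :: (metric_space, complex_banach) complex_banach ..

definition translate :: "real \<Rightarrow> (complex \<Rightarrow>\<^sub>C 'b) \<Rightarrow> (complex \<Rightarrow>\<^sub>C 'b::complex_banach)" where
  "translate t g = Bcontfun (\<lambda>z. apply_bcontfun g (z + complex_of_real t))"

lemma apply_translate: "apply_bcontfun (translate t g) z = apply_bcontfun g (z + complex_of_real t)"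
proof -
  have "(\<lambda>z. apply_bcontfun g (z + complex_of_real t)) \<in> bcontfun"
  proof (rule bcontfun_normI)
    show "continuous_on UNIV (\<lambda>z. apply_bcontfun g (z + complex_of_real t))"
      by (rule continuous_on_compose2[of UNIV "apply_bcontfun g"]) (auto intro!: continuous_intros)
  qed (rule norm_bounded)
  then show ?thesis by (simp add: translate_def Bcontfun_inverse)
qed

interpretation translate: isometric_flow "translate :: real \<Rightarrow> (complex \<Rightarrow>\<^sub>C 'b::complex_banach) \<Rightarrow> _"
proof
  fix s t :: real and a :: complex and x y :: "complex \<Rightarrow>\<^sub>C 'b"
  note [simp] = apply_translate apply_scaleC_bcontfun
  show "translate t (x + y) = translate t x + translate t y"
    and "translate t (a *\<^sub>C x) = a *\<^sub>C translate t x"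
    and comp: "translate s (translate t x) = translate (s + t) x"
    and zero: "translate 0 x = x" for s t and x :: "complex \<Rightarrow>\<^sub>C 'b"
    by (auto intro!: bcontfun_eqI simp: add_ac)
  have le: "norm (translate t x) \<le> norm x" for t and x :: "complex \<Rightarrow>\<^sub>C 'b"
    by (rule norm_bound) (simp add: norm_bounded)
  show "norm (translate t x) = norm x"
    using le[of t x] le[of "- t" "translate t x"] by (simp add: comp zero)
qed

text \<open>Compactness upgrades pointwise to uniform convergence: a sequence of translates with
  parameters tending to 0 has a uniformly convergent subsequence, whose limit must be
  \<open>g\<close> because \<open>g\<close> is continuous at every point.\<close>

lemma tendsto_translate:
  assumes "compact (closure (range (\<lambda>t. translate t g)))"
  shows "((\<lambda>t. translate t g) \<longlongrightarrow> g) (at 0)"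
  unfolding tendsto_at_iff_sequentially
proof (intro allI impI, rule ccontr)
  fix X :: "nat \<Rightarrow> real"
  assume X: "X \<longlonglongrightarrow> 0" and "\<not> ((\<lambda>t. translate t g) \<circ> X) \<longlonglongrightarrow> g"
  then obtain e where e: "e > 0" and "\<And>n. \<exists>m\<ge>n. dist (translate (X m) g) g \<ge> e"
    unfolding lim_sequentially o_def by (metis not_less)
  then have "infinite {m. dist (translate (X m) g) g \<ge> e}"
    unfolding infinite_nat_iff_unbounded_le by auto
  from infinite_enumerate[OF this]
  obtain r :: "nat \<Rightarrow> nat" where r: "strict_mono r" "\<And>n. dist (translate (X (r n)) g) g \<ge> e"
    by auto
  have in_closure: "\<forall>n. translate (X (r n)) g \<in> closure (range (\<lambda>t. translate t g))"
    by (intro allI subsetD[OF closure_subset] rangeI)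
  obtain l q where q: "strict_mono (q :: nat \<Rightarrow> nat)" "((\<lambda>n. translate (X (r n)) g) \<circ> q) \<longlonglongrightarrow> l"
    using seq_compactE[OF compact_imp_seq_compact[OF assms] in_closure] by blast
  have "l = g"
  proof (rule bcontfun_eqI)
    fix z
    have "(\<lambda>n. apply_bcontfun (translate (X (r (q n))) g) z) \<longlonglongrightarrow> apply_bcontfun l z"
      using tendsto_uniform_limitI[OF tendsto_bcontfun_uniform_limit[OF q(2)], of z] by simp
    moreover have "(\<lambda>n. X (r (q n))) \<longlonglongrightarrow> 0"
      using LIMSEQ_subseq_LIMSEQ[OF X strict_mono_o[OF r(1) q(1)]] by (simp add: o_def)
    then have "(\<lambda>n. z + complex_of_real (X (r (q n)))) \<longlonglongrightarrow> z + complex_of_real 0"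
      by (intro tendsto_intros)
    then have "(\<lambda>n. apply_bcontfun g (z + complex_of_real (X (r (q n))))) \<longlonglongrightarrow> apply_bcontfun g z"
      by (intro continuous_on_tendsto_compose[of UNIV "apply_bcontfun g"]) auto
    ultimately show "apply_bcontfun l z = apply_bcontfun g z"
      unfolding apply_translate by (rule LIMSEQ_unique)
  qed
  then have "(\<lambda>n. dist (translate (X (r (q n))) g) g) \<longlonglongrightarrow> 0"
    using q(2) tendsto_dist_iff[of "(\<lambda>n. translate (X (r n)) g) \<circ> q" g sequentially] by (simp add: o_def)
  then have "e \<le> 0" by (rule LIMSEQ_le_const) (use r(2) in blast)
  then show False using e by simp
qed

section \<open>Holomorphic eigenvectors of the translations\<close>

lemma interior_strip: "interior strip = {z. 0 < Im z \<and> Im z < pi}"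
proof
  have "open {z. 0 < Im z \<and> Im z < pi}"
    by (intro open_Collect_conj open_Collect_less continuous_intros)
  then show "{z. 0 < Im z \<and> Im z < pi} \<subseteq> interior strip"
    by (intro interior_maximal) (auto simp: strip_def)
  show "interior strip \<subseteq> {z. 0 < Im z \<and> Im z < pi}"
  proof
    fix z assume "z \<in> interior strip"
    then obtain e where e: "e > 0" "ball z e \<subseteq> strip" by (meson mem_interior)
    have "z + \<i> * complex_of_real s \<in> strip" if "\<bar>s\<bar> < e" for s
      using that by (intro subsetD[OF e(2)]) (simp add: dist_norm norm_mult)
    from this[of "e/2"] this[of "- e/2"] show "z \<in> {z. 0 < Im z \<and> Im z < pi}"
      using e(1) by (simp add: strip_def)
  qed
qed

lemma convex_strip: "convex strip"
proof -
  have "strip = {z. Im z \<ge> 0} \<inter> {z. Im z \<le> pi}" by (auto simp: strip_def)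
  then show ?thesis using convex_Int[OF convex_halfspace_Im_ge convex_halfspace_Im_le] by metis
qed

lemma strip_subset_closure_interior: "strip \<subseteq> closure (interior strip)"
proof -
  have "\<i> \<in> interior strip" using pi_gt3 by (simp add: interior_strip)
  then show ?thesis using convex_closure_interior[OF convex_strip] closure_subset[of strip] by auto
qed

text \<open>Testing by functionals reduces closedness under uniform limits, and later the
  differential equation of an eigenvector, to complex-valued functions.\<close>

definition weakly_holomorphic :: "(complex \<Rightarrow>\<^sub>C 'b::complex_banach) set" where
  "weakly_holomorphic = {g. \<forall>\<phi>. clinear_functional \<phi> \<longrightarrow> (\<lambda>z. \<phi> (apply_bcontfun g z)) holomorphic_on interior strip}"

lemma closed_csubspace_weakly_holomorphic: "closed_csubspace (weakly_holomorphic :: (complex \<Rightarrow>\<^sub>C 'b::complex_banach) set)"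
  unfolding closed_csubspace_def
proof (intro conjI ballI allI)
  show "closed (weakly_holomorphic :: (complex \<Rightarrow>\<^sub>C 'b) set)"
    unfolding closed_sequential_limits
  proof (intro allI impI, elim conjE)
    fix x and l :: "complex \<Rightarrow>\<^sub>C 'b"
    assume x: "\<forall>n. x n \<in> weakly_holomorphic" and l: "x \<longlonglongrightarrow> l"
    show "l \<in> weakly_holomorphic"
      unfolding weakly_holomorphic_def
    proof (intro CollectI allI impI)
      fix \<phi> :: "'b \<Rightarrow> complex" assume \<phi>: "clinear_functional \<phi>"
      then have bl: "bounded_linear \<phi>" by (simp add: clinear_functional_def)
      have lim: "uniform_limit UNIV (\<lambda>n z. \<phi> (apply_bcontfun (x n) z)) (\<lambda>z. \<phi> (apply_bcontfun l z)) sequentially"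
        by (rule bounded_linear.uniform_limit[OF bl tendsto_bcontfun_uniform_limit[OF l]])
      show "(\<lambda>z. \<phi> (apply_bcontfun l z)) holomorphic_on interior strip"
      proof (rule holomorphic_uniform_sequence[OF open_interior])
        show "(\<lambda>z. \<phi> (apply_bcontfun (x n) z)) holomorphic_on interior strip" for n
          using x \<phi> by (simp add: weakly_holomorphic_def)
        show "\<exists>d>0. cball z d \<subseteq> interior strip \<and> uniform_limit (cball z d)
            (\<lambda>n z. \<phi> (apply_bcontfun (x n) z)) (\<lambda>z. \<phi> (apply_bcontfun l z)) sequentially"
          if "z \<in> interior strip" for z
          using open_contains_cball[of "interior strip"] that uniform_limit_on_subset[OF lim] by auto
      qed
    qed
  qed
qed (auto simp: weakly_holomorphic_def clinear_functional_def apply_scaleC_bcontfun linear_simps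
      intro!: holomorphic_intros)

text \<open>
  For an eigenvector, \<open>\<phi> (c (z + t)) = \<zeta> t * \<phi> (c z)\<close>. Holomorphy in \<open>z\<close> makes \<open>\<zeta>\<close> differentiable, so
  every \<open>\<phi> \<circ> c\<close> solves the same equation \<open>h' = a h\<close>; \<open>a\<close> is imaginary because \<open>\<zeta>\<close> is unimodular.
\<close>

lemma eigenvector_eq_exp:
  fixes c :: "complex \<Rightarrow>\<^sub>C 'b::complex_banach"
  assumes hol: "c \<in> weakly_holomorphic" and eig: "c \<in> translate.eigenvectors"
  obtains l :: real and b where "\<And>z. z \<in> strip \<Longrightarrow> apply_bcontfun c z = exp (\<i> * complex_of_real l * z) *\<^sub>C b"
proof -
  have extend: "apply_bcontfun c z = exp (a * z) *\<^sub>C b"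
    if "\<And>z. z \<in> interior strip \<Longrightarrow> apply_bcontfun c z = exp (a * z) *\<^sub>C b" "z \<in> strip" for a b z
  proof -
    have "continuous_on (closure (interior strip)) (\<lambda>z. apply_bcontfun c z - exp (a * z) *\<^sub>C b)"
      by (intro continuous_intros scaleC.continuous_on) simp
    then have "apply_bcontfun c z - exp (a * z) *\<^sub>C b = 0"
      by (rule continuous_constant_on_closure)
        (use that strip_subset_closure_interior in auto)
    then show ?thesis by simp
  qed
  have shift_interior: "z + complex_of_real t \<in> interior strip" if "z \<in> interior strip" for z t
    using that by (simp add: interior_strip)
  show thesis
  proof (cases "\<forall>z\<in>interior strip. apply_bcontfun c z = 0")
    case True
    then show thesis using that[of 0 0] extend[of 0 0] by (simp add: scaleC.zero_right)
  next
    case False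
    then obtain z0 where z0: "z0 \<in> interior strip" "apply_bcontfun c z0 \<noteq> 0" by blast
    obtain \<phi>0 where \<phi>0: "clinear_functional \<phi>0" "\<phi>0 (apply_bcontfun c z0) \<noteq> 0"
      using clinear_functional_separates[OF z0(2)] .
    obtain \<zeta> where \<zeta>: "\<And>t. cmod (\<zeta> t) = 1" "\<And>t. translate t c = \<zeta> t *\<^sub>C c"
      using eig unfolding translate.eigenvectors_def by (simp, metis)
    have per: "apply_bcontfun c (z + complex_of_real t) = \<zeta> t *\<^sub>C apply_bcontfun c z" for z t
      using arg_cong[OF \<zeta>(2), of "\<lambda>g. apply_bcontfun g z"] by (simp add: apply_translate apply_scaleC_bcontfun)
    \<comment> \<open>The complex derivative at \<open>z\<close> can be computed along the real
      direction, where \<open>c\<close> changes only by the multiplier \<zeta>.\<close>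
    have deriv_shift: "((\<lambda>t. \<zeta> t * \<phi> (apply_bcontfun c z)) has_vector_derivative
        deriv (\<lambda>z. \<phi> (apply_bcontfun c z)) z) (at 0)"
      if \<phi>: "clinear_functional \<phi>" and z: "z \<in> interior strip" for \<phi> z
    proof -
      have "((\<lambda>z. \<phi> (apply_bcontfun c z)) has_field_derivative deriv (\<lambda>z. \<phi> (apply_bcontfun c z)) z) (at z)"
        using hol \<phi> z by (intro holomorphic_derivI[OF _ open_interior]) (auto simp: weakly_holomorphic_def)
      then have "((\<lambda>z. \<phi> (apply_bcontfun c z)) has_field_derivative deriv (\<lambda>z. \<phi> (apply_bcontfun c z)) z)
          (at (z + complex_of_real 0))" by simp
      moreover have "((\<lambda>t. z + complex_of_real t) has_vector_derivative 1) (at 0)"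
        by (auto intro!: derivative_eq_intros)
      ultimately have "((\<lambda>z. \<phi> (apply_bcontfun c z)) \<circ> (\<lambda>t. z + complex_of_real t) has_vector_derivative
          1 * deriv (\<lambda>z. \<phi> (apply_bcontfun c z)) z) (at 0)"
        by (rule field_vector_diff_chain_at[rotated])
      then show ?thesis using \<phi> by (simp add: o_def per clinear_functional_def)
    qed
    \<comment> \<open>The logarithmic derivative of \<phi>0 \<circ> c at \<open>z0\<close>. Dividing
      by the nonzero value there identifies it with the derivative of \<zeta> at 0, which involves
      neither the functional nor the point.\<close>
    define a where "a = deriv (\<lambda>z. \<phi>0 (apply_bcontfun c z)) z0 / \<phi>0 (apply_bcontfun c z0)"
    have "((\<lambda>t. \<zeta> t * \<phi>0 (apply_bcontfun c z0) * inverse (\<phi>0 (apply_bcontfun c z0))) has_vector_derivative a) (at 0)"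
      unfolding a_def divide_inverse
      by (intro has_vector_derivative_mult_left deriv_shift \<phi>0 z0)
    then have \<zeta>': "(\<zeta> has_vector_derivative a) (at 0)"
      using \<phi>0(2) by (simp add: mult.assoc)
    have ode: "deriv (\<lambda>z. \<phi> (apply_bcontfun c z)) z = a * \<phi> (apply_bcontfun c z)"
      if "clinear_functional \<phi>" "z \<in> interior strip" for \<phi> z
      by (rule vector_derivative_unique_at[OF deriv_shift[OF that] has_vector_derivative_mult_left[OF \<zeta>']])
    define b where "b = exp (- a * z0) *\<^sub>C apply_bcontfun c z0"
    have c_eq: "apply_bcontfun c z = exp (a * z) *\<^sub>C b" if z: "z \<in> interior strip" for z
    proof (rule ccontr)
      assume "apply_bcontfun c z \<noteq> exp (a * z) *\<^sub>C b"
      then obtain \<phi> where \<phi>: "clinear_functional \<phi>" "\<phi> (apply_bcontfun c z - exp (a * z) *\<^sub>C b) \<noteq> 0"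
        using clinear_functional_separates[of "apply_bcontfun c z - exp (a * z) *\<^sub>C b"] by auto
      have dz: "((\<lambda>w. \<phi> (apply_bcontfun c w) * exp (- a * w)) has_field_derivative 0) (at w within interior strip)"
        if w: "w \<in> interior strip" for w
      proof -
        have d: "((\<lambda>z. \<phi> (apply_bcontfun c z)) has_field_derivative a * \<phi> (apply_bcontfun c w)) (at w)"
          unfolding ode[OF \<phi>(1) w, symmetric]
          using hol \<phi>(1) w by (intro holomorphic_derivI[OF _ open_interior]) (auto simp: weakly_holomorphic_def)
        have e: "((\<lambda>w. exp (- a * w)) has_field_derivative - a * exp (- a * w)) (at w)"
          by (auto intro!: derivative_eq_intros)
        have "((\<lambda>w. \<phi> (apply_bcontfun c w) * exp (- a * w)) has_field_derivative 0) (at w)"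
          by (rule DERIV_cong[OF DERIV_mult[OF d e]]) algebra
        then show ?thesis by (rule has_field_derivative_at_within)
      qed
      from has_field_derivative_zero_constant[OF convex_interior[OF convex_strip] dz]
      obtain k where k: "\<And>w. w \<in> interior strip \<Longrightarrow> \<phi> (apply_bcontfun c w) * exp (- a * w) = k"
        by blast
      have "\<phi> (apply_bcontfun c z) = k * exp (a * z)"
        using k[OF z] by (simp add: exp_minus field_simps)
      also have "\<dots> = \<phi> (exp (a * z) *\<^sub>C b)"
        using \<phi>(1) k[OF z0(1)] by (simp add: b_def clinear_functional_def mult_ac)
      finally show False using \<phi> by (simp add: clinear_functional_def linear_simps)
    qed
    have "b \<noteq> 0" using c_eq[OF z0(1)] z0(2) by (auto simp: scaleC.zero_right)
    have "norm (apply_bcontfun c (z0 + complex_of_real 1)) = norm (apply_bcontfun c z0)"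
      unfolding per by (simp add: norm_scaleC \<zeta>(1))
    then have "exp (Re (a * (z0 + 1))) = exp (Re (a * z0))"
      using c_eq[OF z0(1)] c_eq[OF shift_interior[OF z0(1), of 1]] \<open>b \<noteq> 0\<close> by (simp add: norm_scaleC)
    then have "Re a = 0" by (simp add: algebra_simps)
    then have "a = \<i> * complex_of_real (Im a)" by (simp add: complex_eq_iff)
    then show thesis using that[of "Im a" b] extend[OF c_eq] by metis
  qed
qed

text \<open>
  Composition with the projection of the plane onto the strip embeds \<open>Cb strip\<close> isometrically into a
  Banach space that is a type, and the embedding commutes with horizontal translations.
\<close>

definition strip_clamp :: "complex \<Rightarrow> complex" where
  "strip_clamp z = Complex (Re z) (max 0 (min pi (Im z)))"

lemma strip_clamp_in_strip: "strip_clamp z \<in> strip"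
  by (simp add: strip_clamp_def strip_def)

lemma strip_clamp_id: "z \<in> strip \<Longrightarrow> strip_clamp z = z"
  by (simp add: strip_clamp_def strip_def complex_eq_iff)

lemma strip_clamp_add_of_real: "strip_clamp (z + complex_of_real t) = strip_clamp z + complex_of_real t"
  by (simp add: strip_clamp_def complex_eq_iff)

definition extend_strip :: "(complex \<Rightarrow> 'b) \<Rightarrow> (complex \<Rightarrow>\<^sub>C 'b::complex_banach)" where
  "extend_strip f = Bcontfun (\<lambda>z. f (strip_clamp z))"

lemma apply_extend_strip:
  fixes f :: "complex \<Rightarrow> 'b::complex_banach"
  assumes "f \<in> mspace (Cb strip)"
  shows "apply_bcontfun (extend_strip f) z = f (strip_clamp z)"
proof -
  have f: "continuous_on strip f" "bounded (f ` strip)" using assms by (auto simp: mspace_Cb)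
  have "strip_clamp = (\<lambda>z. complex_of_real (Re z) + \<i> * complex_of_real (max 0 (min pi (Im z))))"
    by (auto simp: strip_clamp_def complex_eq_iff)
  moreover have "continuous_on UNIV (\<lambda>z. complex_of_real (Re z) + \<i> * complex_of_real (max 0 (min pi (Im z))))"
    by (intro continuous_intros)
  ultimately have "continuous_on UNIV strip_clamp" by metis
  then have "continuous_on UNIV (\<lambda>z. f (strip_clamp z))"
    using strip_clamp_in_strip by (intro continuous_on_compose2[OF f(1)]) auto
  moreover have "bounded (range (\<lambda>z. f (strip_clamp z)))"
    by (rule bounded_subset[OF f(2)]) (use strip_clamp_in_strip in auto)
  ultimately show ?thesis by (simp add: extend_strip_def Bcontfun_inverse bcontfun_def)
qed

definition restrict_strip :: "(complex \<Rightarrow>\<^sub>C 'b::complex_banach) \<Rightarrow> complex \<Rightarrow> 'b" where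
  "restrict_strip g = restrict (apply_bcontfun g) strip"

lemma restrict_strip_in_Cb: "restrict_strip g \<in> mspace (Cb strip)"
proof -
  have "bounded (apply_bcontfun g ` strip)"
    by (rule bounded_subset[OF bounded_apply_bcontfun[of g]]) auto
  then show ?thesis by (simp add: restrict_strip_def mspace_Cb)
qed

lemma restrict_extend_strip: "f \<in> mspace (Cb strip) \<Longrightarrow> restrict_strip (extend_strip f) = f"
  by (rule extensionalityI[of _ strip])
    (auto simp: restrict_strip_def apply_extend_strip strip_clamp_id mspace_Cb)

lemma strip_nonempty: "strip \<noteq> {}"
  using strip_clamp_in_strip by blast

lemma mdist_restrict_strip_le: "mdist (Cb strip) (restrict_strip g) (restrict_strip h) \<le> dist g h"
  unfolding mdist_Cb[OF restrict_strip_in_Cb restrict_strip_in_Cb strip_nonempty]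
  by (rule cSUP_least[OF strip_nonempty]) (use dist_bounded[of g _ h] in \<open>simp add: restrict_strip_def dist_norm\<close>)

lemma dist_extend_strip_le:
  assumes f: "f \<in> mspace (Cb strip)" and g: "g \<in> mspace (Cb strip)"
  shows "dist (extend_strip f) (extend_strip g) \<le> mdist (Cb strip) f g"
proof (rule dist_bound)
  fix z
  have "bounded ((\<lambda>z. f z - g z) ` strip)"
    using f g by (intro bounded_minus_comp) (auto simp: mspace_Cb)
  then have "bdd_above ((\<lambda>z. norm (f z - g z)) ` strip)"
    by (intro bounded_imp_bdd_above) (simp add: bounded_norm_comp)
  then show "dist (extend_strip f z) (extend_strip g z) \<le> mdist (Cb strip) f g"
    unfolding mdist_Cb[OF f g strip_nonempty] apply_extend_strip[OF f] apply_extend_strip[OF g] dist_norm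
    by (intro cSUP_upper strip_clamp_in_strip)
qed

lemma continuous_map_extend_strip:
  "continuous_map (mtopology_of (Cb strip)) euclidean (extend_strip :: (complex \<Rightarrow> 'b::complex_banach) \<Rightarrow> _)"
proof -
  have "Lipschitz_continuous_map (Cb strip) euclidean_metric (extend_strip :: (complex \<Rightarrow> 'b) \<Rightarrow> _)"
    unfolding Lipschitz_continuous_map_def using dist_extend_strip_le by (auto intro!: exI[of _ 1])
  then show ?thesis
    using uniformly_continuous_imp_continuous_map[OF Lipschitz_imp_uniformly_continuous_map] by fastforce
qed

lemma continuous_map_restrict_strip:
  "continuous_map euclidean (mtopology_of (Cb strip)) (restrict_strip :: (complex \<Rightarrow>\<^sub>C 'b::complex_banach) \<Rightarrow> _)"
proof -
  have "Lipschitz_continuous_map euclidean_metric (Cb strip) (restrict_strip :: (complex \<Rightarrow>\<^sub>C 'b) \<Rightarrow> _)"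
    unfolding Lipschitz_continuous_map_def
    using mdist_restrict_strip_le restrict_strip_in_Cb by (auto intro!: exI[of _ 1])
  then show ?thesis
    using uniformly_continuous_imp_continuous_map[OF Lipschitz_imp_uniformly_continuous_map] by fastforce
qed

lemma translate_extend_strip:
  assumes f: "f \<in> mspace (Cb strip)"
  shows "translate t (extend_strip f) = extend_strip (shift strip t f)"
proof (rule bcontfun_eqI)
  fix z
  show "apply_bcontfun (translate t (extend_strip f)) z = apply_bcontfun (extend_strip (shift strip t f)) z"
    unfolding apply_translate apply_extend_strip[OF f] apply_extend_strip[OF shift_in_Cb[OF f]]
    by (simp add: strip_clamp_add_of_real shift_def strip_clamp_in_strip)
qed

lemma APH_D:
  assumes "f \<in> mspace (APH strip)"
  shows "f \<in> mspace (Cb strip)" "vec_holomorphic_on f (interior strip)"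
    "compactin (mtopology_of (Cb strip)) (mtopology_of (Cb strip) closure_of range (\<lambda>x. shift strip x f))"
  using assms by (auto simp: APH_def)

text \<open>The embedding is continuous, so it maps the compact closure of the shifts to a compact,
  hence closed, set containing the translates.\<close>

lemma compact_orbit_extend_strip:
  fixes f :: "complex \<Rightarrow> 'b::complex_banach"
  assumes "f \<in> mspace (APH strip)"
  shows "compact (closure (range (\<lambda>t. translate t (extend_strip f))))"
proof -
  note f = APH_D[OF assms]
  define K where "K = mtopology_of (Cb strip) closure_of range (\<lambda>x. shift strip x f)"
  have "compactin euclidean (extend_strip ` K)"
    using image_compactin[OF _ continuous_map_extend_strip] f(3) by (simp add: K_def)
  then have cpt: "compact (extend_strip ` K)" by simp
  have "range (\<lambda>x. shift strip x f) \<subseteq> K"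
    unfolding K_def using shift_in_Cb[OF f(1)] by (intro closure_of_subset) auto
  then have "range (\<lambda>t. translate t (extend_strip f)) \<subseteq> extend_strip ` K"
    by (auto simp: translate_extend_strip[OF f(1)])
  then have "closure (range (\<lambda>t. translate t (extend_strip f))) \<subseteq> extend_strip ` K"
    by (rule closure_minimal) (rule compact_imp_closed[OF cpt])
  then show ?thesis using cpt by (metis closed_closure closed_Int_compact inf.absorb1)
qed

text \<open>A bounded complex-linear functional turns the derivative with vector \<open>D\<close>
  into multiplication by \<open>\<phi> D\<close>. Real translations preserve the interior, where the
  clamp is the identity.\<close>

lemma extend_strip_weakly_holomorphic:
  fixes f :: "complex \<Rightarrow> 'b::complex_banach"
  assumes f: "f \<in> mspace (Cb strip)" and hol: "vec_holomorphic_on f (interior strip)"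
  shows "translate t (extend_strip f) \<in> weakly_holomorphic"
  unfolding weakly_holomorphic_def
proof (intro CollectI allI impI)
  fix \<phi> :: "'b \<Rightarrow> complex" assume \<phi>: "clinear_functional \<phi>"
  then have bl: "bounded_linear \<phi>" by (simp add: clinear_functional_def)
  have "(\<lambda>z. \<phi> (f z)) holomorphic_on interior strip"
    unfolding holomorphic_on_def field_differentiable_def has_field_derivative_def
  proof
    fix z assume "z \<in> interior strip"
    then obtain D where "(f has_derivative (\<lambda>h. h *\<^sub>C D)) (at z within interior strip)"
      using hol by (auto simp: vec_holomorphic_on_def)
    then have "((\<lambda>z. \<phi> (f z)) has_derivative (\<lambda>h. \<phi> (h *\<^sub>C D))) (at z within interior strip)"
      by (rule bounded_linear.has_derivative[OF bl])
    then show "\<exists>f'. ((\<lambda>z. \<phi> (f z)) has_derivative (*) f') (at z within interior strip)"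
      using \<phi> by (intro exI[of _ "\<phi> D"]) (simp add: clinear_functional_def mult.commute[of _ "\<phi> D"] o_def)
  qed
  then have "(\<lambda>z. \<phi> (f z)) \<circ> (\<lambda>z. z + complex_of_real t) holomorphic_on interior strip"
    by (intro holomorphic_on_compose_gen[where t = "interior strip"] holomorphic_intros)
      (auto simp: interior_strip)
  then show "(\<lambda>z. \<phi> (apply_bcontfun (translate t (extend_strip f)) z)) holomorphic_on interior strip"
  proof (rule holomorphic_transform)
    fix z assume "z \<in> interior strip"
    then have "0 < Im z \<and> Im z < pi" by (simp add: interior_strip)
    then have "z + complex_of_real t \<in> strip" by (simp add: strip_def)
    then show "((\<lambda>z. \<phi> (f z)) \<circ> (\<lambda>z. z + complex_of_real t)) z
        = \<phi> (apply_bcontfun (translate t (extend_strip f)) z)"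
      by (simp add: apply_translate apply_extend_strip[OF f] strip_clamp_id)
  qed
qed

section \<open>Exponential sums and their density\<close>

definition exp_term :: "real \<Rightarrow> 'b::complex_banach \<Rightarrow> complex \<Rightarrow> 'b" where
  "exp_term l b = restrict (\<lambda>z. exp (\<i> * complex_of_real l * z) *\<^sub>C b) strip"

lemma exp_term_in_Cb: "exp_term l b \<in> mspace (Cb strip)"
proof -
  have "continuous_on strip (\<lambda>z. exp (\<i> * complex_of_real l * z) *\<^sub>C b)"
    by (intro scaleC.continuous_on continuous_intros)
  \<comment> \<open>The modulus of the exponential is exp(- l Im z), with Im z between 0 and
    pi.\<close>
  moreover have "norm (exp (\<i> * complex_of_real l * z) *\<^sub>C b) \<le> exp (\<bar>l\<bar> * pi) * norm b" if "z \<in> strip" for z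
  proof -
    have "- l * Im z \<le> \<bar>l\<bar> * \<bar>Im z\<bar>" by (metis abs_ge_minus_self abs_mult mult_minus_left)
    also have "\<dots> \<le> \<bar>l\<bar> * pi" using that by (intro mult_left_mono) (auto simp: strip_def)
    finally show ?thesis by (simp add: norm_scaleC mult_right_mono)
  qed
  then have "bounded (exp_term l b ` strip)" unfolding exp_term_def by (intro boundedI) auto
  ultimately show ?thesis by (auto simp: mspace_Cb exp_term_def)
qed

lemma apply_extend_exp_term:
  "apply_bcontfun (extend_strip (exp_term l b)) z = exp (\<i> * complex_of_real l * strip_clamp z) *\<^sub>C b"
  unfolding apply_extend_strip[OF exp_term_in_Cb] by (simp add: exp_term_def strip_clamp_in_strip)

lemma exp_sums_restrict_strip:
  "restrict (\<lambda>z. \<Sum>k\<in>I. exp (\<i> * complex_of_real (l k) * z) *\<^sub>C b k) strip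
    = restrict_strip (\<Sum>k\<in>I. extend_strip (exp_term (l k) (b k)))"
proof -
  have "apply_bcontfun (\<Sum>k\<in>I. extend_strip (exp_term (l k) (b k))) z
      = (\<Sum>k\<in>I. apply_bcontfun (extend_strip (exp_term (l k) (b k))) z)" for z
    by (induction I rule: infinite_finite_induct) auto
  then show ?thesis
    by (auto simp: restrict_strip_def apply_extend_exp_term strip_clamp_id restrict_def fun_eq_iff
        intro!: sum.cong)
qed

text \<open>A real shift multiplies each exponential by a unimodular number, so all shifts of a sum
  lie in one compact set of combinations with coefficients in the unit disc.\<close>

lemma exp_sums_subset_APH: "exp_sums strip \<subseteq> mspace (APH strip :: (complex \<Rightarrow> 'b::complex_banach) metric)"
proof
  fix g :: "complex \<Rightarrow> 'b" assume "g \<in> exp_sums strip"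
  then obtain m :: nat and l b
    where g: "g = restrict (\<lambda>z. \<Sum>k = 1..m. exp (\<i> * complex_of_real (l k) * z) *\<^sub>C b k) strip"
    unfolding exp_sums_def by auto
  define E where "E k = extend_strip (exp_term (l k) (b k))" for k
  define Q where "Q = {\<Sum>k\<in>{1..m}. a k *\<^sub>C E k | a. \<forall>k\<in>{1..m}. cmod (a k) \<le> 1}"
  have gE: "g = restrict_strip (\<Sum>k = 1..m. E k)"
    unfolding g E_def by (rule exp_sums_restrict_strip)
  then have gC: "g \<in> mspace (Cb strip)" by (simp add: restrict_strip_in_Cb)
  have "compactin euclidean Q" unfolding Q_def by (simp add: compact_disc_combinations)
  then have K: "compactin (mtopology_of (Cb strip)) (restrict_strip ` Q)"
    by (rule image_compactin[OF _ continuous_map_restrict_strip])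
  have "shift strip x g \<in> restrict_strip ` Q" for x
  proof
    show "shift strip x g = restrict_strip (\<Sum>k = 1..m. exp (\<i> * complex_of_real (l k) * complex_of_real x) *\<^sub>C E k)"
    proof -
      have tr: "translate x (E k) = exp (\<i> * complex_of_real (l k) * complex_of_real x) *\<^sub>C E k" for k
      proof (rule bcontfun_eqI)
        fix z
        show "apply_bcontfun (translate x (E k)) z
            = apply_bcontfun (exp (\<i> * complex_of_real (l k) * complex_of_real x) *\<^sub>C E k) z"
          by (simp add: E_def apply_translate apply_scaleC_bcontfun apply_extend_exp_term
              strip_clamp_add_of_real scaleC_scaleC exp_add [symmetric] algebra_simps)
      qed
      have "shift strip x g = restrict_strip (translate x (\<Sum>k = 1..m. E k))"
        unfolding gE by (auto simp: shift_def restrict_strip_def apply_translate fun_eq_iff strip_def)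
      then show ?thesis by (simp add: translate.flow_sum tr)
    qed
    show "(\<Sum>k = 1..m. exp (\<i> * complex_of_real (l k) * complex_of_real x) *\<^sub>C E k) \<in> Q"
      unfolding Q_def
      by (intro CollectI exI[of _ "\<lambda>k. exp (\<i> * complex_of_real (l k) * complex_of_real x)"]) simp
  qed
  moreover have "closedin (mtopology_of (Cb strip)) (restrict_strip ` Q)"
    using K by (intro compactin_imp_closedin)
      (auto simp: mtopology_of_def intro: Metric_space.Hausdorff_space_mtopology)
  ultimately have "mtopology_of (Cb strip) closure_of range (\<lambda>x. shift strip x g) \<subseteq> restrict_strip ` Q"
    by (intro closure_of_minimal) auto
  then have cpt: "compactin (mtopology_of (Cb strip)) (mtopology_of (Cb strip) closure_of range (\<lambda>x. shift strip x g))"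
    by (rule closed_compactin[OF K]) simp
  have "vec_holomorphic_on g (interior strip)"
    unfolding vec_holomorphic_on_def
  proof
    fix z assume z: "z \<in> interior strip"
    let ?D = "\<Sum>k = 1..m. (exp (\<i> * complex_of_real (l k) * z) * (\<i> * complex_of_real (l k))) *\<^sub>C b k"
    have "((\<lambda>z. exp (\<i> * complex_of_real (l k) * z)) has_derivative
        (\<lambda>h. h * (exp (\<i> * complex_of_real (l k) * z) * (\<i> * complex_of_real (l k))))) (at z within interior strip)" for k
      by (auto intro!: derivative_eq_intros simp: algebra_simps)
    then have "((\<lambda>z. \<Sum>k = 1..m. exp (\<i> * complex_of_real (l k) * z) *\<^sub>C b k) has_derivative
        (\<lambda>h. \<Sum>k = 1..m. (h * (exp (\<i> * complex_of_real (l k) * z) * (\<i> * complex_of_real (l k)))) *\<^sub>C b k))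
        (at z within interior strip)"
      by (intro has_derivative_sum bounded_linear.has_derivative[OF scaleC.bounded_linear_left])
    then have "((\<lambda>z. \<Sum>k = 1..m. exp (\<i> * complex_of_real (l k) * z) *\<^sub>C b k) has_derivative
        (\<lambda>h. h *\<^sub>C ?D)) (at z within interior strip)"
      by (simp add: scaleC.sum_right scaleC_scaleC)
    then have "(g has_derivative (\<lambda>h. h *\<^sub>C ?D)) (at z within interior strip)"
      by (rule has_derivative_transform[OF z, rotated]) (use interior_subset in \<open>auto simp: g\<close>)
    then show "\<exists>D. (g has_derivative (\<lambda>h. h *\<^sub>C D)) (at z within interior strip)" by blast
  qed
  then show "g \<in> mspace (APH strip)" using gC cpt by (simp add: APH_def)
qed

text \<open>The eigenvectors approximating the extension of \<open>f\<close> are weakly holomorphic,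
  hence exponentials on the strip, and restriction to the strip does not increase distances.\<close>

lemma exp_sums_dense:
  fixes f :: "complex \<Rightarrow> 'b::complex_banach"
  assumes f: "f \<in> mspace (APH strip)" and \<epsilon>: "\<epsilon> > 0"
  shows "\<exists>g \<in> exp_sums strip. mdist (Cb strip) f g < \<epsilon>"
proof -
  note fD = APH_D[OF f]
  note cpt = compact_orbit_extend_strip[OF f]
  obtain R :: "nat set" and c where R: "finite R"
    and c: "\<And>r. r \<in> R \<Longrightarrow> c r \<in> weakly_holomorphic \<inter> translate.eigenvectors"
    and approx: "norm (extend_strip f - (\<Sum>r\<in>R. c r)) < \<epsilon>"
    using translate.eigenvector_approximation[OF cpt tendsto_translate[OF cpt]
        closed_csubspace_weakly_holomorphic _ \<epsilon>] extend_strip_weakly_holomorphic[OF fD(1,2)]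
    by (metis image_subsetI)
  have "\<exists>l b. \<forall>z\<in>strip. apply_bcontfun (c r) z = exp (\<i> * complex_of_real l * z) *\<^sub>C b" if "r \<in> R" for r
    using eigenvector_eq_exp[of "c r"] c[OF that] by (metis IntE)
  then obtain l b where lb: "\<And>r z. r \<in> R \<Longrightarrow> z \<in> strip \<Longrightarrow>
      apply_bcontfun (c r) z = exp (\<i> * complex_of_real (l r) * z) *\<^sub>C b r" by metis
  \<comment> \<open>\<open>exp_sums\<close> numbers its terms from 1 to \<open>m\<close>, so
    \<open>R\<close> is enumerated; an empty \<open>R\<close> gives \<open>m = 0\<close> and the
    zero function.\<close>
  obtain \<pi> where \<pi>: "bij_betw \<pi> {1..card R} R"
    using ex_bij_betw_nat_finite_1[OF R] by blast
  define g where "g = restrict (\<lambda>z. \<Sum>k = 1..card R. exp (\<i> * complex_of_real ((l \<circ> \<pi>) k) * z) *\<^sub>C (b \<circ> \<pi>) k) strip"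
  have "g \<in> exp_sums strip" unfolding exp_sums_def g_def by blast
  moreover have "g = restrict_strip (\<Sum>r\<in>R. c r)"
  proof -
    have "apply_bcontfun (\<Sum>r\<in>R. c r) z = (\<Sum>r\<in>R. apply_bcontfun (c r) z)" for z
      by (induction R rule: infinite_finite_induct) auto
    then show ?thesis
      unfolding g_def restrict_strip_def
      using sum.reindex_bij_betw[OF \<pi>, of "\<lambda>r. exp (\<i> * complex_of_real (l r) * _) *\<^sub>C b r"]
      by (auto simp: fun_eq_iff restrict_def lb intro!: sum.cong)
  qed
  then have "mdist (Cb strip) f g \<le> dist (extend_strip f) (\<Sum>r\<in>R. c r)"
    using mdist_restrict_strip_le[of "extend_strip f" "\<Sum>r\<in>R. c r"] by (simp add: restrict_extend_strip[OF fD(1)])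
  ultimately show ?thesis using approx by (intro bexI[of _ g]) (auto simp: dist_norm)
qed

theorem theorem1p4:
  shows "(exp_sums strip :: (complex \<Rightarrow> 'b::complex_banach) set) \<subseteq> mspace (APH strip) \<and>
    mtopology_of (APH strip) closure_of (exp_sums strip :: (complex \<Rightarrow> 'b) set) =
      mspace (APH strip)"
proof
  show sub: "(exp_sums strip :: (complex \<Rightarrow> 'b) set) \<subseteq> mspace (APH strip)"
    by (rule exp_sums_subset_APH)
  show "mtopology_of (APH strip) closure_of (exp_sums strip :: (complex \<Rightarrow> 'b) set) = mspace (APH strip)"
  proof
    show "mtopology_of (APH strip) closure_of (exp_sums strip :: (complex \<Rightarrow> 'b) set) \<subseteq> mspace (APH strip)"
      using closure_of_subset_topspace[of "mtopology_of (APH strip)"] by simp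
    show "mspace (APH strip) \<subseteq> mtopology_of (APH strip) closure_of (exp_sums strip :: (complex \<Rightarrow> 'b) set)"
    proof
      fix f :: "complex \<Rightarrow> 'b" assume f: "f \<in> mspace (APH strip)"
      interpret M: Metric_space "mspace (APH strip :: (complex \<Rightarrow> 'b) metric)" "mdist (APH strip)" by simp
      have "\<exists>g\<in>exp_sums strip. g \<in> M.mball f r" if r: "r > 0" for r
      proof -
        obtain g where g: "g \<in> exp_sums strip" "mdist (Cb strip) f g < r"
          using exp_sums_dense[OF f r] by blast
        have "mdist (APH strip) f g < r" using g(2) unfolding APH_def mdist_submetric .
        then have "g \<in> M.mball f r" unfolding M.in_mball using f g(1) sub by blast
        then show ?thesis using g(1) by blast
      qed
      then show "f \<in> mtopology_of (APH strip) closure_of (exp_sums strip :: (complex \<Rightarrow> 'b) set)"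
        using f by (simp add: mtopology_of_def M.metric_closure_of)
    qed
  qed
qed

end
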